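(* Let $P_{\mathbb{N}}\in\mathcal{M}(\mathbb{R}^{\mathbb{N}})$ be a probability measure such that the coordinate process $(Z_i)_{i\in\mathbb{N}}$, $Z_i:\mathbb{R}^{\mathbb{N}}\to\mathbb{R}$, is bounded, strongly (strictly) stationary, and $\alpha$-mixing with $$\sum_{m>n}\alpha\big(\sigma(Z_1,\dots,Z_i),\sigma(Z_{i+m},Z_{i+m+1},\dots),P_{\mathbb{N}}\big)=O(n^{-\gamma}),\quad i\in\mathbb{N},\ \text{for some }\gamma>0 .$$ Let $\mathcal{P}\subset\mathcal{M}(\mathbb{R}^{\mathbb{N}})$ be the set of probability measures under which the coordinate process has these properties for the same $\gamma>0$. Let $H$ be a Polish space with metric $d_H$, and let $(S_n)_{n\in\mathbb{N}}$, $S_n:\mathbb{R}^n\to H$, be a sequence of estimators represented by a statistical operator $S:\mathcal{M}(\mathbb{R})\to H$, i.e. $S_n(z_1,\dots,z_n)=S\big(\frac1n\sum_{i=1}^n\delta_{z_i}\big)$ for all $n\in\mathbb{N}$ and $(z_1,\dots,z_n)\in\mathbb{R}^n$. Assume that each $S_n$ is continuous and that $S$ is uniformly continuous with respect to $d_{\mathrm{BL}}$. Let the bootstrap approximations, for $P_{\mathbb{N}}$ and for every $Q_{\mathbb{N}}\in\mathcal{P}$, be those of the moving block bootstrap with integer block lengths $b(n)$ and numbers of blocks $\ell(n)$ satisfying $$n^h\in O(b(n)),\quad b(n)\in O(n^{1/3-a})\quad\text{for some } 0<h<\tfrac13-a,\ 0<a<\tfrac13,$$ $b(n)=b(2^q)$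 for $2^q\le n<2^{q+1}$, $q\in\mathbb{N}$, $b(n)\to\infty$ as $n\to\infty$, and $b(n)\,\ell(n)=n$, $n\in\mathbb{N}$ (with the truncation convention for the last block when $b(n)$ does not divide $n$). Then the sequence of bootstrap approximations $(\mathcal{L}_{P_n^*}(S_n))_{n\in\mathbb{N}}$ is qualitatively robust at $P_{\mathbb{N}}$ with respect to $\mathcal{P}$; that is, for every $\varepsilon>0$ there are $\delta>0$ and $n_0\in\mathbb{N}$ such that for every $n\ge n_0$ and every $Q_{\mathbb{N}}\in\mathcal{P}$, $$d_{\mathrm{BL}}(P_n,Q_n)<\delta\ \Rightarrow\ d_{\mathrm{BL}}\big(\mathcal{L}(\mathcal{L}_{P_n^*}(S_n)),\mathcal{L}(\mathcal{L}_{Q_n^*}(S_n))\big)<\varepsilon .$$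
   Context: All topological spaces carry their Borel $\sigma$-algebras. $\mathcal{M}(\mathcal{X})$ denotes the set of Borel probability measures on $\mathcal{X}$; for a Polish space $\mathcal{X}$, $\mathcal{M}(\mathcal{X})$ with the weak topology is Polish. Write $\mathcal{Z}=\mathbb{R}$ with its usual metric $d_{\mathcal{Z}}$. $\mathcal{M}(\mathcal{Z}^{\mathbb{N}})$ is the set of probability measures on $\mathcal{Z}^{\mathbb{N}}$ with the product $\sigma$-algebra. The coordinate process is $Z_i:\mathcal{Z}^{\mathbb{N}}\to\mathcal{Z}$, $(z_j)_{j\in\mathbb{N}}\mapsto z_i$. For $P_{\mathbb{N}}\in\mathcal{M}(\mathcal{Z}^{\mathbb{N}})$, $P_n$ denotes the law of $(Z_1,\dots,Z_n)$ under $P_{\mathbb{N}}$ (similarly $Q_n$ for $Q_{\mathbb{N}}$). Mixing coefficient: for $\sigma$-algebras $\mathcal{A}_1,\mathcal{A}_2$ and a probability measure $\mu$, $\alpha(\mathcal{A}_1,\mathcal{A}_2,\mu)=\sup\{|\mu(A_1\cap A_2)-\mu(A_1)\mu(A_2)|: A_1\in\mathcal{A}_1,A_2\in\mathcal{A}_2\}$. A process $(Z_i)$ is $\alpha$-mixing with respect to $\mu$ if $\lim_{n\to\infty}\sup_{i\ge1}\alpha(\sigma(Z_i),\sigma(Z_{i+n}),\mu)=0$. Bounded Lipschitz metric: for a separable metric space $(\mathcal{X},d)$ and $\mu,\nu\in\mathcal{M}(\mathcal{X})$, $d_{\mathrm{BL}}(\mu,\nu)=\sup\{|\int f\,d\mu-\int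 f\,d\nu| : f:\mathcal{X}\to\mathbb{R},\ \|f\|_{\mathrm{BL}}\le 1\}$, where $\|f\|_{\mathrm{BL}}=\sup_{x\ne y}\frac{|f(x)-f(y)|}{d(x,y)}+\sup_x|f(x)|$. On $\mathcal{M}(\mathcal{Z}^n)$ it is formed with respect to the metric $d_n\big((z_1,\dots,z_n),(z_1',\dots,z_n')\big)=\inf\{\varepsilon>0:\ \sharp\{i: d_{\mathcal{Z}}(z_i,z_i')\ge\varepsilon\}/n\le\varepsilon\}$ on $\mathcal{Z}^n$ (which induces the product topology). On $\mathcal{M}(\mathcal{M}(H))$ it is formed with respect to the metric $d_{\mathrm{BL}}$ on $\mathcal{M}(H)$. Continuity of $S_n$ is with respect to the product topology on $\mathcal{Z}^n$. Moving block bootstrap: let $(Z_1,\dots,Z_n)\sim P_n$, let $b=b(n)<n$ be the block length and $\ell=\ell(n)$ the number of blocks. Put $Z_{n+j}=Z_j$ (circular extension) and form the blocks $B_{i,b}=(Z_i,\dots,Z_{i+b-1})$, $i=1,\dots,n$. Draw $I_1,\dots,I_\ell$ independently and uniformly with replacement from $\{1,\dots,n\}$, independently of $(Z_1,\dots,Z_n)$. The bootstrap sample $(Z_1^*,\dots,Z_n^* )$ is the concatenation of $B_{I_1,b},\dots,B_{I_\ell,b}$, of length $\ell b=n$; if $n$ is not a multiple of $b$, one uses $\ell=\lceil n/b\rceil$ blocks and cuts the last block so that the total length is $n$. The bootstrap approximation of $P_n$ is the random probability measure $P_n^*=\bigotimes_{i=1}^n\big(\frac1n\sum_{j=1}^n\delta_{Z_j^*}\big)$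 on $\mathcal{Z}^n$. $\mathcal{L}_{P_n^*}(S_n)$ denotes the image measure of $P_n^*$ under $S_n$; it is a random element of $\mathcal{M}(H)$, and $\mathcal{L}(\mathcal{L}_{P_n^*}(S_n))\in\mathcal{M}(\mathcal{M}(H))$ is its distribution. $Q_n^*$ and $\mathcal{L}(\mathcal{L}_{Q_n^*}(S_n))$ are defined in the same way starting from $Q_n$, with the same $b(n),\ell(n)$. *)

theory Defs
  imports "HOL-Probability.Probability" "HOL-Library.Landau_Symbols"
begin

text \<open>
  Conventions. Index sets are 1-based: a point of \<open>\<real>\<^sup>n\<close> is an extensional function on \<open>{1..n}\<close> and
  a point of \<open>\<real>\<^sup>\<nat>\<close> an extensional function on \<open>{1..}\<close>, so that the \<open>i\<close>-th coordinate process is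
  \<open>\<lambda>\<omega>. \<omega> i\<close> for \<open>i \<ge> 1\<close>. The set of probability measures with the \<open>\<sigma>\<close>-algebra of \<open>M\<close> is
  \<open>space (prob_algebra M)\<close>; only this carrier is used, not the \<open>\<sigma>\<close>-algebra of \<open>prob_algebra M\<close>.
\<close>

abbreviation seq_space :: "(nat \<Rightarrow> real) measure" where
  "seq_space \<equiv> Pi\<^sub>M {1..} (\<lambda>_. borel)"

abbreviation vec_space :: "nat \<Rightarrow> (nat \<Rightarrow> real) measure" where
  "vec_space n \<equiv> Pi\<^sub>M {1..n} (\<lambda>_. borel)"

definition marginal :: "nat \<Rightarrow> (nat \<Rightarrow> real) measure \<Rightarrow> (nat \<Rightarrow> real) measure" where
  "marginal n P = distr P (vec_space n) (\<lambda>\<omega>. restrict \<omega> {1..n})"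


subsection \<open>Bounded Lipschitz metric\<close>

text \<open>
  The norm is \<open>ennreal\<close>-valued: it is infinite for functions that are not bounded Lipschitz, and the
  supremum over pairs of distinct points is 0 on a one-point space.
\<close>

definition bl_norm :: "'x set \<Rightarrow> ('x \<Rightarrow> 'x \<Rightarrow> real) \<Rightarrow> ('x \<Rightarrow> real) \<Rightarrow> ennreal" where
  "bl_norm X d f =
     (SUP (x, y) \<in> {(x, y). x \<in> X \<and> y \<in> X \<and> x \<noteq> y}. ennreal (\<bar>f x - f y\<bar> / d x y))
     + (SUP x \<in> X. ennreal \<bar>f x\<bar>)"

definition d_BL :: "'x set \<Rightarrow> ('x \<Rightarrow> 'x \<Rightarrow> real) \<Rightarrow> 'x measure \<Rightarrow> 'x measure \<Rightarrow> real" where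
  "d_BL X d \<mu> \<nu> =
     (SUP f \<in> {f. bl_norm X d f \<le> 1}. \<bar>(\<integral>x. f x \<partial>\<mu>) - (\<integral>x. f x \<partial>\<nu>)\<bar>)"

definition d_vec :: "nat \<Rightarrow> (nat \<Rightarrow> real) \<Rightarrow> (nat \<Rightarrow> real) \<Rightarrow> real" where
  "d_vec n z z' =
     Inf {\<epsilon>. \<epsilon> > 0 \<and> real (card {i \<in> {1..n}. dist (z i) (z' i) \<ge> \<epsilon>}) / real n \<le> \<epsilon>}"


subsection \<open>Probability measures with the weak topology\<close>

definition weak_topology :: "'a::topological_space measure topology" where
  "weak_topology = topology_generated_by
     {{\<mu> \<in> space (prob_algebra borel). (\<integral>x. f x \<partial>\<mu>) \<in> U} | (f :: 'a \<Rightarrow> real) U.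
        continuous_on UNIV f \<and> bounded (range f) \<and> open U}"

definition borel_of :: "'a topology \<Rightarrow> 'a measure" where
  "borel_of T = sigma (topspace T) {U. openin T U}"


subsection \<open>Stationarity and mixing of the coordinate process\<close>

definition bounded_process :: "(nat \<Rightarrow> real) measure \<Rightarrow> bool" where
  "bounded_process P \<longleftrightarrow> (\<exists>C. AE \<omega> in P. \<forall>i\<ge>1. \<bar>\<omega> i\<bar> \<le> C)"

definition strictly_stationary :: "(nat \<Rightarrow> real) measure \<Rightarrow> bool" where
  "strictly_stationary P \<longleftrightarrow>
     (\<forall>J k. finite J \<and> J \<subseteq> {1..} \<longrightarrow>
        distr P (Pi\<^sub>M J (\<lambda>_. borel)) (\<lambda>\<omega>. \<lambda>j\<in>J. \<omega> (j + k)) =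
        distr P (Pi\<^sub>M J (\<lambda>_. borel)) (\<lambda>\<omega>. \<lambda>j\<in>J. \<omega> j))"

definition coord_sigma :: "nat set \<Rightarrow> (nat \<Rightarrow> real) set set" where
  "coord_sigma J = sigma_sets (space seq_space)
     {{\<omega> \<in> space seq_space. \<omega> i \<in> B} | i B. i \<in> J \<and> B \<in> sets borel}"

definition alpha_coeff :: "'w set set \<Rightarrow> 'w set set \<Rightarrow> 'w measure \<Rightarrow> real" where
  "alpha_coeff \<A> \<B> \<mu> =
     (SUP (A, B) \<in> \<A> \<times> \<B>. \<bar>measure \<mu> (A \<inter> B) - measure \<mu> A * measure \<mu> B\<bar>)"

definition alpha_mixing :: "(nat \<Rightarrow> real) measure \<Rightarrow> bool" where
  "alpha_mixing P \<longleftrightarrow>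
     (\<lambda>n. SUP i\<in>{1..}. alpha_coeff (coord_sigma {i}) (coord_sigma {i + n}) P) \<longlonglongrightarrow> 0"

text \<open>
  The value of \<open>infsum\<close> is 0 for a divergent series, so summability is required explicitly.
\<close>

definition alpha_tails :: "real \<Rightarrow> (nat \<Rightarrow> real) measure \<Rightarrow> bool" where
  "alpha_tails \<gamma> P \<longleftrightarrow>
     (\<forall>i\<ge>1.
        (\<lambda>m. alpha_coeff (coord_sigma {1..i}) (coord_sigma {i + m..}) P) summable_on {1..} \<and>
        (\<lambda>n. \<Sum>\<^sub>\<infinity>m\<in>{n<..}. alpha_coeff (coord_sigma {1..i}) (coord_sigma {i + m..}) P)
          \<in> O(\<lambda>n. real n powr (- \<gamma>)))"

definition mixing_class :: "real \<Rightarrow> (nat \<Rightarrow> real) measure set" where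
  "mixing_class \<gamma> = {P \<in> space (prob_algebra seq_space).
     bounded_process P \<and> strictly_stationary P \<and> alpha_mixing P \<and> alpha_tails \<gamma> P}"


subsection \<open>Moving block bootstrap\<close>

definition empirical :: "nat \<Rightarrow> (nat \<Rightarrow> real) \<Rightarrow> real measure" where
  "empirical n z = measure_of UNIV (sets borel)
     (\<lambda>A. (\<Sum>i=1..n. emeasure (return borel (z i)) A) / of_nat n)"

text \<open>
  Circular extension: \<open>(k - 1) mod n + 1\<close> is the representative of \<open>k\<close> in \<open>{1..n}\<close>, so that
  \<open>Z\<^bsub>n+j\<^esub> = Z\<^sub>j\<close>.
\<close>

definition circular :: "nat \<Rightarrow> (nat \<Rightarrow> real) \<Rightarrow> nat \<Rightarrow> real" where
  "circular n z k = z ((k - 1) mod n + 1)"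

definition block :: "nat \<Rightarrow> nat \<Rightarrow> (nat \<Rightarrow> real) \<Rightarrow> nat \<Rightarrow> real list" where
  "block n b z i = map (circular n z) [i..<i + b]"

text \<open>
  The concatenation of the blocks starting at \<open>I 1, \<dots>, I l\<close>, cut to length \<open>n\<close>.
\<close>

definition bootstrap_sample ::
    "nat \<Rightarrow> nat \<Rightarrow> nat \<Rightarrow> (nat \<Rightarrow> real) \<Rightarrow> (nat \<Rightarrow> nat) \<Rightarrow> nat \<Rightarrow> real" where
  "bootstrap_sample n b l z I =
     (let zs = take n (concat (map (\<lambda>k. block n b z (I k)) [1..<l + 1]))
      in (\<lambda>j\<in>{1..n}. zs ! (j - 1)))"

definition bootstrap_approx :: "nat \<Rightarrow> (nat \<Rightarrow> real) \<Rightarrow> (nat \<Rightarrow> real) measure" where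
  "bootstrap_approx n zstar = Pi\<^sub>M {1..n} (\<lambda>_. empirical n zstar)"

text \<open>
  The distribution, as a probability measure on the Borel sets of the space of probability measures
  on \<open>'h\<close>, of the random law of the estimator under the bootstrap approximation. The underlying
  probability space carries the data \<open>z\<close> with law \<open>Pn\<close> and, independently of \<open>z\<close>, the i.i.d. uniform
  block starting points \<open>I 1, \<dots>, I l\<close>.
\<close>

definition bootstrap_law ::
    "nat \<Rightarrow> nat \<Rightarrow> nat \<Rightarrow> (nat \<Rightarrow> real) measure \<Rightarrow> ((nat \<Rightarrow> real) \<Rightarrow> 'h::topological_space)
      \<Rightarrow> 'h measure measure" where
  "bootstrap_law n b l Pn T =
     distr (Pn \<Otimes>\<^sub>M Pi\<^sub>M {1..l} (\<lambda>_. uniform_count_measure {1..n}))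
       (borel_of weak_topology)
       (\<lambda>(z, I). distr (bootstrap_approx n (bootstrap_sample n b l z I)) borel T)"

end

theory Submission
  imports Defs
begin

text \<open>
  The bootstrap has two resampling steps, the choice of blocks and the draws from the empirical
  measure of the bootstrap sample. Given the data, both read the data at random positions, and the
  law of the positions does not depend on the data. For two data vectors \<open>z\<close> and \<open>z'\<close> the same
  positions can be used. Each single position is uniform on \<open>{1..n}\<close>: for the draws this is their
  definition, and for the blocks it holds because of the circular extension of the sample. Hence the
  mean of the truncated coordinate distances \<open>min 2 \<bar>z i - z' i\<bar>\<close> is preserved in expectation by each
  step (\<open>integral_mean_dist_resampled\<close>, \<open>integral_mean_dist_bootstrap_sample\<close>). This mean bounds the
  bounded Lipschitz distance of the two empirical measures (\<open>d_BL_empirical_le\<close>), and it is itself at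
  most \<open>3 * d_vec n z z'\<close> (\<open>mean_dist_le_d_vec\<close>).

  Uniform continuity of \<open>S\<close> is used in the affine form
  \<open>min 2 (dist (S \<mu>) (S \<nu>)) \<le> \<epsilon> + K * d_BL UNIV dist \<mu> \<nu>\<close>
  (\<open>uniformly_continuous_affine_bound\<close>), which can be integrated over the positions. So if \<open>F\<close> is a test
  function on the space of laws and \<open>f z\<close> is the conditional expectation, given the data \<open>z\<close>, of the
  value of \<open>F\<close> at the bootstrap law of the estimator, then \<open>f\<close> has a modulus of continuity
  \<open>\<epsilon> + K * mean_dist n z z'\<close> that depends neither on \<open>n\<close> nor on \<open>F\<close>. By infimal convolution \<open>f\<close> is
  within \<open>\<epsilon>\<close> of a \<open>K\<close>-Lipschitz function (\<open>lipschitz_lower_approximation\<close>), whose integrals under two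
  data distributions differ by at most \<open>3 * K + 1\<close> times their bounded Lipschitz distance. The result,
  \<open>d_BL_bootstrap_law_le\<close>, is robustness uniformly over all data distributions and sample sizes.

  The random law of the estimator is a measurable function of the data and the blocks because, for
  each of the finitely many choices of blocks, it is continuous in the data for the weak topology
  (\<open>measurable_estimator_law\<close>).
\<close>

\<comment> \<open>Intervals start at 1 throughout; as \<open>Suc 0\<close> the bound would no longer match the rules below.\<close>
declare One_nat_def [simp del]

section \<open>The bounded Lipschitz metric\<close>

text \<open>
  Pairs at distance zero do no harm: the quotient is then \<open>x / 0 = 0\<close>.
\<close>

lemma bl_norm_le_oneI:
  fixes f :: "'x \<Rightarrow> real"
  assumes d: "\<And>x y. x \<in> X \<Longrightarrow> y \<in> X \<Longrightarrow> 0 \<le> d x y"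
    and lip: "\<And>x y. x \<in> X \<Longrightarrow> y \<in> X \<Longrightarrow> \<bar>f x - f y\<bar> \<le> L * d x y"
    and bd: "\<And>x. x \<in> X \<Longrightarrow> \<bar>f x\<bar> \<le> M"
    and "0 \<le> L" "0 \<le> M" "L + M \<le> 1"
  shows "bl_norm X d f \<le> 1"
proof -
  have q: "\<bar>f x - f y\<bar> / d x y \<le> L" if "x \<in> X" "y \<in> X" for x y
    using d[OF that] lip[OF that] \<open>0 \<le> L\<close>
    by (cases "d x y = 0") (auto simp: divide_le_eq mult.commute)
  have "bl_norm X d f \<le> ennreal L + ennreal M"
    unfolding bl_norm_def
    by (intro add_mono SUP_least) (auto intro!: ennreal_leI q bd)
  also have "\<dots> \<le> ennreal 1"
    using assms by (subst ennreal_plus[symmetric]) (auto intro!: ennreal_leI simp del: ennreal_plus)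
  finally show ?thesis by simp
qed

lemma bl_norm_le_one_bounded:
  assumes "bl_norm X d f \<le> 1" "x \<in> X"
  shows "\<bar>f x\<bar> \<le> 1"
proof -
  have "ennreal \<bar>f x\<bar> \<le> (SUP x \<in> X. ennreal \<bar>f x\<bar>)"
    using assms by (intro SUP_upper)
  also have "\<dots> \<le> bl_norm X d f" unfolding bl_norm_def by (simp add: add_increasing)
  also have "\<dots> \<le> ennreal 1" using assms by simp
  finally show ?thesis by (subst (asm) ennreal_le_iff) auto
qed

text \<open>
  For distinct points the distance must be positive, since the norm does not see a pair of distinct
  points at distance zero. This is why definiteness of the bounded Lipschitz metric is proved below.
\<close>

lemma bl_norm_le_one_lipschitz:
  assumes "bl_norm X d f \<le> 1" "x \<in> X" "y \<in> X" "x \<noteq> y \<Longrightarrow> 0 < d x y" "0 \<le> d x y"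
  shows "\<bar>f x - f y\<bar> \<le> d x y"
proof (cases "x = y")
  case False
  have "ennreal (\<bar>f x - f y\<bar> / d x y) \<le>
      (SUP (x, y) \<in> {(x, y). x \<in> X \<and> y \<in> X \<and> x \<noteq> y}. ennreal (\<bar>f x - f y\<bar> / d x y))"
    using assms False by (intro SUP_upper2[of "(x, y)"]) auto
  also have "\<dots> \<le> bl_norm X d f" unfolding bl_norm_def by (simp add: add_increasing2)
  also have "\<dots> \<le> ennreal 1" using assms by simp
  finally have "\<bar>f x - f y\<bar> / d x y \<le> 1" by (subst (asm) ennreal_le_iff) auto
  then show ?thesis using assms False by (simp add: divide_le_eq)
qed (use assms in auto)

lemma bl_norm_zero: "bl_norm X d (\<lambda>_. 0) \<le> 1"
proof -
  have "bl_norm X d (\<lambda>_. 0) \<le> 0 + 0"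
    unfolding bl_norm_def by (intro add_mono SUP_least) auto
  then show ?thesis by (simp add: order_trans[OF _ zero_le_one])
qed

text \<open>
  A non-integrable function has integral 0, so the bound covers every function of norm at most 1,
  measurable or not, and all of these enter the supremum that defines \<open>d_BL\<close>.
\<close>

lemma prob_integral_abs_le:
  fixes f :: "'x \<Rightarrow> real"
  assumes "prob_space M" "\<And>x. x \<in> space M \<Longrightarrow> \<bar>f x\<bar> \<le> c" "0 \<le> c"
  shows "\<bar>\<integral>x. f x \<partial>M\<bar> \<le> c"
proof (cases "integrable M f")
  case True
  interpret prob_space M by fact
  have "\<bar>\<integral>x. f x \<partial>M\<bar> \<le> (\<integral>x. \<bar>f x\<bar> \<partial>M)" by (rule integral_abs_bound)
  also have "\<dots> \<le> (\<integral>x. c \<partial>M)" using True assms by (intro integral_mono) auto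
  also have "\<dots> = c" by (simp add: prob_space)
  finally show ?thesis .
qed (simp add: not_integrable_integral_eq assms)

text \<open>
  The real supremum in \<open>d_BL\<close> is meaningful only if it is taken over a bounded set; for probability
  measures 2 is a bound.
\<close>

lemma d_BL_upper:
  assumes "prob_space \<mu>" "prob_space \<nu>" "space \<mu> \<subseteq> X" "space \<nu> \<subseteq> X" "bl_norm X d f \<le> 1"
  shows "\<bar>(\<integral>x. f x \<partial>\<mu>) - (\<integral>x. f x \<partial>\<nu>)\<bar> \<le> d_BL X d \<mu> \<nu>"
  unfolding d_BL_def
proof (rule cSUP_upper)
  show "bdd_above ((\<lambda>f. \<bar>(\<integral>x. f x \<partial>\<mu>) - (\<integral>x. f x \<partial>\<nu>)\<bar>) ` {f. bl_norm X d f \<le> 1})"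
  proof (rule bdd_aboveI2[where M = 2])
    fix g assume g: "g \<in> {f. bl_norm X d f \<le> 1}"
    have "\<bar>\<integral>x. g x \<partial>\<mu>\<bar> \<le> 1" "\<bar>\<integral>x. g x \<partial>\<nu>\<bar> \<le> 1"
      using assms g by (auto intro!: prob_integral_abs_le dest: bl_norm_le_one_bounded)
    then show "\<bar>(\<integral>x. g x \<partial>\<mu>) - (\<integral>x. g x \<partial>\<nu>)\<bar> \<le> 2" by linarith
  qed
qed (use assms in auto)

lemma d_BL_least:
  assumes "\<And>f. bl_norm X d f \<le> 1 \<Longrightarrow> \<bar>(\<integral>x. f x \<partial>\<mu>) - (\<integral>x. f x \<partial>\<nu>)\<bar> \<le> c"
  shows "d_BL X d \<mu> \<nu> \<le> c"
  unfolding d_BL_def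
proof (rule cSUP_least)
  show "{f. bl_norm X d f \<le> 1} \<noteq> {}" using bl_norm_zero by blast
qed (rule assms, simp)

lemma d_BL_nonneg:
  assumes "prob_space \<mu>" "prob_space \<nu>" "space \<mu> \<subseteq> X" "space \<nu> \<subseteq> X"
  shows "0 \<le> d_BL X d \<mu> \<nu>"
  using d_BL_upper[OF assms bl_norm_zero] by simp

lemma bl_norm_dist_lipschitz:
  fixes f :: "'x::metric_space \<Rightarrow> real"
  assumes "bl_norm UNIV dist f \<le> 1"
  shows "\<bar>f x - f y\<bar> \<le> dist x y"
  using bl_norm_le_one_lipschitz[OF assms, of x y] by auto

lemma bl_norm_dist_measurable:
  fixes f :: "'x::metric_space \<Rightarrow> real"
  assumes "bl_norm UNIV dist f \<le> 1"
  shows "f \<in> borel_measurable borel"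
proof -
  have "1-lipschitz_on UNIV f"
    using bl_norm_dist_lipschitz[OF assms] by (auto intro!: lipschitz_onI simp: dist_real_def)
  then show ?thesis
    by (intro borel_measurable_continuous_onI lipschitz_on_continuous_on)
qed

lemma space_prob_algebra_borelD:
  assumes "\<mu> \<in> space (prob_algebra borel)"
  shows "sets \<mu> = sets borel" "space \<mu> = UNIV" "prob_space \<mu>"
  using assms sets_eq_imp_space_eq[of \<mu> borel] by (auto simp: space_prob_algebra)

text \<open>
  The indicator of an open set \<open>U\<close> is the increasing limit of the bounded Lipschitz functions
  \<open>min 1 (k * infdist x (- U))\<close>, and open sets generate the Borel sets. The lemma is applied to laws
  of estimators: it lets a function of norm at most 1 on the space of laws inherit the Lipschitz
  inequality.
\<close>

lemma d_BL_eq_0_imp_eq: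
  fixes \<mu> \<nu> :: "'x::metric_space measure"
  assumes mem: "\<mu> \<in> space (prob_algebra borel)" "\<nu> \<in> space (prob_algebra borel)"
    and zero: "d_BL UNIV dist \<mu> \<nu> = 0"
  shows "\<mu> = \<nu>"
proof -
  interpret m: prob_space \<mu> using space_prob_algebra_borelD[OF mem(1)] by simp
  interpret n: prob_space \<nu> using space_prob_algebra_borelD[OF mem(2)] by simp
  note [simp] = space_prob_algebra_borelD(1,2)[OF mem(1)] space_prob_algebra_borelD(1,2)[OF mem(2)]
  note [measurable_cong] = space_prob_algebra_borelD(1)[OF mem(1)] space_prob_algebra_borelD(1)[OF mem(2)]
  have "emeasure \<mu> U = emeasure \<nu> U" if U: "open U" for U
  proof (cases "U = UNIV")
    case True
    then show ?thesis using m.emeasure_space_1 n.emeasure_space_1 by simp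
  next
    case False
    define f where "f k x = min 1 (real k * infdist x (- U))" for k x
    have f01: "0 \<le> f k x" "f k x \<le> 1" for k x by (auto simp: f_def infdist_nonneg)
    have lip: "\<bar>f k x - f k y\<bar> \<le> real k * dist x y" for k x y
    proof -
      have "\<bar>f k x - f k y\<bar> \<le> \<bar>real k * infdist x (- U) - real k * infdist y (- U)\<bar>"
        by (auto simp: f_def)
      also have "\<dots> = real k * \<bar>infdist x (- U) - infdist y (- U)\<bar>"
        by (simp add: abs_mult right_diff_distrib[symmetric])
      also have "\<dots> \<le> real k * dist x y"
        using infdist_triangle_abs[of x "- U" y] by (intro mult_left_mono) auto
      finally show ?thesis .
    qed
    have [measurable]: "f k \<in> borel_measurable borel" for k
      unfolding f_def by (intro borel_measurable_continuous_onI continuous_intros)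
    have eq: "(\<integral>x. f k x \<partial>\<mu>) = (\<integral>x. f k x \<partial>\<nu>)" for k
    proof -
      define g where "g x = f k x / (real k + 1)" for x
      have "bl_norm UNIV dist g \<le> 1"
      proof (rule bl_norm_le_oneI[where L = "real k / (real k + 1)" and M = "1 / (real k + 1)"])
        show "\<bar>g x - g y\<bar> \<le> real k / (real k + 1) * dist x y" for x y
          using lip[of k x y] by (simp add: g_def diff_divide_distrib[symmetric] divide_right_mono)
        show "\<bar>g x\<bar> \<le> 1 / (real k + 1)" for x
          using f01[of k x] by (simp add: g_def divide_right_mono)
      qed (auto simp: add_divide_distrib[symmetric])
      then have "\<bar>(\<integral>x. g x \<partial>\<mu>) - (\<integral>x. g x \<partial>\<nu>)\<bar> \<le> 0"
        using d_BL_upper[of \<mu> \<nu> UNIV dist g] zero m.prob_space_axioms n.prob_space_axioms by simp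
      then show ?thesis by (simp add: g_def)
    qed
    have lim: "(\<lambda>k. f k x) \<longlonglongrightarrow> indicator U x" for x
    proof (cases "x \<in> U")
      case True
      have "infdist x (- U) > 0"
        using in_closed_iff_infdist_zero[of "- U" x] U True False infdist_nonneg[of x "-U"]
        by (auto simp: less_le closed_def)
      then obtain N :: nat where N: "1 \<le> real N * infdist x (- U)"
        by (metis ex_less_of_nat_mult less_imp_le)
      have "f k x = 1" if "k \<ge> N" for k
      proof -
        have "real N * infdist x (- U) \<le> real k * infdist x (- U)"
          using that by (intro mult_right_mono infdist_nonneg) auto
        with N show ?thesis by (simp add: f_def)
      qed
      then show ?thesis using True
        by (intro tendsto_eventually) (auto simp: eventually_sequentially)
    next
      case False
      then show ?thesis by (simp add: f_def)
    qed
    have "(\<lambda>k. \<integral>x. f k x \<partial>\<mu>) \<longlonglongrightarrow> (\<integral>x. indicator U x \<partial>\<mu>)"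
      using U f01 lim by (intro integral_dominated_convergence[where w = "\<lambda>_. 1"])
        (auto intro!: borel_measurable_indicator)
    moreover have "(\<lambda>k. \<integral>x. f k x \<partial>\<nu>) \<longlonglongrightarrow> (\<integral>x. indicator U x \<partial>\<nu>)"
      using U f01 lim by (intro integral_dominated_convergence[where w = "\<lambda>_. 1"])
        (auto intro!: borel_measurable_indicator)
    ultimately have "measure \<mu> U = measure \<nu> U"
      using eq LIMSEQ_unique by (auto simp: U)
    then show ?thesis by (simp add: m.emeasure_eq_measure n.emeasure_eq_measure)
  qed
  then show ?thesis
    by (intro measure_eqI_generator_eq[where E = "{U. open U}" and \<Omega> = UNIV and A = "\<lambda>_. UNIV"])
      (auto simp: Int_stable_def sets_borel m.emeasure_eq_measure)
qed

text \<open>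
  A coupling bound. The truncation at 2 comes from the bound 1 on the test functions; it keeps the
  right-hand side finite and turns closeness in probability into closeness in mean.
\<close>

lemma d_BL_distr_le:
  fixes X Y :: "'u \<Rightarrow> 'x::{metric_space, second_countable_topology}"
  assumes "prob_space U" and [measurable]: "X \<in> U \<rightarrow>\<^sub>M borel" "Y \<in> U \<rightarrow>\<^sub>M borel"
  shows "d_BL UNIV dist (distr U borel X) (distr U borel Y) \<le> (\<integral>u. min 2 (dist (X u) (Y u)) \<partial>U)"
proof (rule d_BL_least)
  interpret prob_space U by fact
  fix f :: "'x \<Rightarrow> real" assume f: "bl_norm UNIV dist f \<le> 1"
  note [measurable] = bl_norm_dist_measurable[OF f]
  have f1: "\<bar>f x\<bar> \<le> 1" for x using bl_norm_le_one_bounded[OF f] by simp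
  have int: "integrable U (\<lambda>u. f (X u))" "integrable U (\<lambda>u. f (Y u))"
    by (auto intro!: integrable_const_bound[where B = 1] f1)
  have "\<bar>(\<integral>x. f x \<partial>distr U borel X) - (\<integral>x. f x \<partial>distr U borel Y)\<bar>
      = \<bar>\<integral>u. f (X u) - f (Y u) \<partial>U\<bar>"
    by (simp add: integral_distr int)
  also have "\<dots> \<le> (\<integral>u. \<bar>f (X u) - f (Y u)\<bar> \<partial>U)" by (rule integral_abs_bound)
  also have "\<dots> \<le> (\<integral>u. min 2 (dist (X u) (Y u)) \<partial>U)"
  proof (rule integral_mono)
    show "integrable U (\<lambda>u. min 2 (dist (X u) (Y u)))"
      by (rule integrable_const_bound[where B = 2]) auto
    show "\<bar>f (X u) - f (Y u)\<bar> \<le> min 2 (dist (X u) (Y u))" for u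
      using bl_norm_dist_lipschitz[OF f, of "X u" "Y u"] f1[of "X u"] f1[of "Y u"] by auto
  qed (use int in auto)
  finally show "\<bar>(\<integral>x. f x \<partial>distr U borel X) - (\<integral>x. f x \<partial>distr U borel Y)\<bar>
      \<le> (\<integral>u. min 2 (dist (X u) (Y u)) \<partial>U)" .
qed

section \<open>Truncated mean distance of samples\<close>

text \<open>
  Unlike \<open>d_vec\<close>, this pseudometric is an average over coordinates. Its expectation under random
  resampling of the coordinates can therefore be computed exactly, by linearity.
\<close>

definition mean_dist :: "nat \<Rightarrow> (nat \<Rightarrow> real) \<Rightarrow> (nat \<Rightarrow> real) \<Rightarrow> real" where
  "mean_dist n z z' = (\<Sum>i=1..n. min 2 (dist (z i) (z' i))) / real n"

lemma mean_dist_nonneg: "0 \<le> mean_dist n z z'"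
  by (auto simp: mean_dist_def intro!: divide_nonneg_nonneg sum_nonneg)

lemma mean_dist_self [simp]: "mean_dist n z z = 0"
  by (simp add: mean_dist_def)

lemma mean_dist_commute: "mean_dist n z z' = mean_dist n z' z"
  by (simp add: mean_dist_def dist_commute)

lemma mean_dist_triangle: "mean_dist n x z \<le> mean_dist n x y + mean_dist n y z"
proof -
  have "min 2 (dist (x i) (z i)) \<le> min 2 (dist (x i) (y i)) + min 2 (dist (y i) (z i))" for i
    using dist_triangle[of "x i" "z i" "y i"] zero_le_dist[of "x i" "y i"] zero_le_dist[of "y i" "z i"]
    by linarith
  then show ?thesis
    unfolding mean_dist_def add_divide_distrib[symmetric] sum.distrib[symmetric]
    by (intro divide_right_mono sum_mono) auto
qed

text \<open>
  If at most a fraction \<open>\<epsilon>\<close> of the coordinates differ by \<open>\<epsilon>\<close> or more, the other coordinates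
  contribute at most \<open>\<epsilon>\<close> to the mean and the exceptional ones at most \<open>2 * \<epsilon>\<close>.
\<close>

lemma mean_dist_le_d_vec:
  assumes "n \<ge> 1"
  shows "mean_dist n z z' \<le> 3 * d_vec n z z'"
proof -
  define E where "E = {\<epsilon>. \<epsilon> > 0 \<and> real (card {i \<in> {1..n}. dist (z i) (z' i) \<ge> \<epsilon>}) / real n \<le> \<epsilon>}"
  have "card {i \<in> {1..n}. dist (z i) (z' i) \<ge> 1} \<le> card {1..n}"
    by (intro card_mono) auto
  then have "1 \<in> E" using assms by (auto simp: E_def)
  moreover have "mean_dist n z z' / 3 \<le> e" if "e \<in> E" for e
  proof -
    let ?B = "{i \<in> {1..n}. dist (z i) (z' i) \<ge> e}"
    have e: "e > 0" "real (card ?B) / real n \<le> e" using that by (auto simp: E_def)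
    have "(\<Sum>i=1..n. min 2 (dist (z i) (z' i))) \<le> (\<Sum>i=1..n. e + (if i \<in> ?B then 2 else 0))"
      using e by (intro sum_mono) auto
    also have "\<dots> = real n * e + 2 * real (card ?B)"
      by (simp add: sum.distrib sum.If_cases Int_def mult.commute)
    finally have "mean_dist n z z' \<le> (real n * e + 2 * real (card ?B)) / real n"
      unfolding mean_dist_def by (intro divide_right_mono) auto
    also have "\<dots> = e + 2 * (real (card ?B) / real n)"
      using assms by (simp add: add_divide_distrib)
    finally show ?thesis using e by linarith
  qed
  ultimately have "mean_dist n z z' / 3 \<le> Inf E"
    by (intro cInf_greatest) auto
  then show ?thesis by (simp add: d_vec_def E_def)
qed

lemma empirical_eq_distr:
  assumes "n \<ge> 1"
  shows "empirical n z = distr (uniform_count_measure {1..n}) borel z"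
proof -
  have "(\<Sum>i=1..n. emeasure (return borel (z i)) A) / of_nat n =
      emeasure (uniform_count_measure {1..n}) (z -` A \<inter> {1..n})"
    if A: "A \<in> sets borel" for A
  proof -
    have "(\<Sum>i=1..n. emeasure (return borel (z i)) A) = (\<Sum>i=1..n. if i \<in> z -` A then 1 else 0)"
      using A by (intro sum.cong) (auto simp: indicator_def)
    also have "\<dots> = of_nat (card (z -` A \<inter> {1..n}))"
      by (simp add: sum.If_cases vimage_def Int_commute)
    finally show ?thesis
      using assms by (subst emeasure_uniform_count_measure)
        (auto simp: ennreal_of_nat_eq_real_of_nat divide_ennreal)
  qed
  then show ?thesis
    unfolding empirical_def distr_def
    by (auto simp: space_uniform_count_measure sets.sigma_sets_eq[of borel, simplified] intro!: measure_of_eq)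
qed

lemma prob_space_uniform_index: "n \<ge> 1 \<Longrightarrow> prob_space (uniform_count_measure {1..n::nat})"
  by (rule prob_space_uniform_count_measure) auto

lemma measurable_from_uniform: "space N = UNIV \<Longrightarrow> z \<in> uniform_count_measure A \<rightarrow>\<^sub>M N"
  by (simp add: measurable_cong_sets[OF sets_uniform_count_measure_count_space refl])

lemma empirical_in_prob_algebra:
  assumes "n \<ge> 1"
  shows "empirical n z \<in> space (prob_algebra borel)"
  using assms by (auto simp: empirical_eq_distr space_prob_algebra measurable_from_uniform
      intro!: prob_space.prob_space_distr prob_space_uniform_index)

text \<open>
  Both empirical measures are images of the same uniform index, which is the coupling used.
\<close>

lemma d_BL_empirical_le:
  assumes "n \<ge> 1"
  shows "d_BL UNIV dist (empirical n z) (empirical n z') \<le> mean_dist n z z'"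
  using d_BL_distr_le[OF prob_space_uniform_index[OF assms], of z z'] assms
  by (simp add: empirical_eq_distr measurable_from_uniform integral_uniform_count_measure mean_dist_def)

section \<open>Uniform indices and resampling\<close>

abbreviation uniform_indices :: "nat \<Rightarrow> nat \<Rightarrow> (nat \<Rightarrow> nat) measure" where
  "uniform_indices m n \<equiv> Pi\<^sub>M {1..m} (\<lambda>_. uniform_count_measure {1..n})"

lemma prob_space_uniform_indices: "n \<ge> 1 \<Longrightarrow> prob_space (uniform_indices m n)"
  by (intro prob_space_PiM prob_space_uniform_index)

lemma sets_uniform_indices:
  "sets (uniform_indices m n) = sets (count_space (PiE {1..m} (\<lambda>_. {1..n})))"
proof -
  have "sets (uniform_indices m n) = sets (Pi\<^sub>M {1..m} (\<lambda>_. count_space {1..n}))"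
    by (intro sets_PiM_cong) (auto simp: sets_uniform_count_measure)
  also have "\<dots> = sets (count_space (PiE {1..m} (\<lambda>_. {1..n})))"
    by (subst count_space_PiM_finite) auto
  finally show ?thesis .
qed

lemma space_uniform_indices: "space (uniform_indices m n) = PiE {1..m} (\<lambda>_. {1..n})"
  by (simp add: space_PiM space_uniform_count_measure)

lemma measurable_uniform_indices:
  "space N = UNIV \<Longrightarrow> f \<in> uniform_indices m n \<rightarrow>\<^sub>M N"
  by (simp add: measurable_cong_sets[OF sets_uniform_indices refl])

lemma integrable_uniform_indices [simp]:
  fixes f :: "(nat \<Rightarrow> nat) \<Rightarrow> real"
  assumes "n \<ge> 1"
  shows "integrable (uniform_indices m n) f"
proof -
  interpret prob_space "uniform_indices m n" by (rule prob_space_uniform_indices[OF assms])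
  have fin: "finite (space (uniform_indices m n))"
    unfolding space_uniform_indices by (intro finite_PiE) auto
  have "\<bar>f x\<bar> \<le> (\<Sum>y\<in>space (uniform_indices m n). \<bar>f y\<bar>)" if "x \<in> space (uniform_indices m n)" for x
    using fin that by (intro member_le_sum) auto
  then show ?thesis
    by (intro integrable_const_bound[where B = "\<Sum>y\<in>space (uniform_indices m n). \<bar>f y\<bar>"])
      (auto intro!: AE_I2 measurable_uniform_indices)
qed

lemma integral_uniform_indices_component:
  fixes g :: "nat \<Rightarrow> real"
  assumes "n \<ge> 1" "k \<in> {1..m}"
  shows "(\<integral>I. g (I k) \<partial>uniform_indices m n) = (\<Sum>i=1..n. g i) / real n"
proof -
  have "(\<integral>I. g (I k) \<partial>uniform_indices m n) =
      (\<integral>i. g i \<partial>distr (uniform_indices m n) (uniform_count_measure {1..n}) (\<lambda>I. I k))"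
    using assms(2) by (intro integral_distr[symmetric] measurable_component_singleton
        measurable_from_uniform) auto
  also have "\<dots> = (\<integral>i. g i \<partial>uniform_count_measure {1..n})"
    using assms by (subst distr_PiM_component) (auto intro!: prob_space_uniform_index)
  finally show ?thesis by (simp add: integral_uniform_count_measure)
qed

text \<open>
  The index space is finite, so the integral is a finite linear combination of the integrands.
\<close>

lemma continuous_map_integral_uniform_indices:
  fixes \<phi> :: "'x \<Rightarrow> (nat \<Rightarrow> nat) \<Rightarrow> real"
  assumes n: "n \<ge> 1"
    and cont: "\<And>I. I \<in> space (uniform_indices m n) \<Longrightarrow> continuous_map X euclideanreal (\<lambda>x. \<phi> x I)"
  shows "continuous_map X euclideanreal (\<lambda>x. \<integral>I. \<phi> x I \<partial>uniform_indices m n)"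
proof -
  let ?U = "uniform_indices m n"
  interpret prob_space ?U by (rule prob_space_uniform_indices[OF n])
  have fin: "finite (space ?U)"
    unfolding space_uniform_indices by (intro finite_PiE) auto
  have sing: "{I} \<in> sets ?U" if "I \<in> space ?U" for I
    using that unfolding sets_uniform_indices space_uniform_indices by auto
  have "(\<integral>I. \<phi> x I \<partial>?U) = (\<Sum>I\<in>space ?U. measure ?U {I} * \<phi> x I)" for x
  proof -
    have "(\<integral>I. \<phi> x I \<partial>?U) = (\<integral>I. (\<Sum>J\<in>space ?U. \<phi> x J * indicator {J} I) \<partial>?U)"
      using fin by (intro Bochner_Integration.integral_cong)
        (auto simp: indicator_def sum.delta if_distrib cong: if_cong)
    also have "\<dots> = (\<Sum>J\<in>space ?U. \<phi> x J * measure ?U {J})"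
      using n sing by (subst Bochner_Integration.integral_sum) (auto simp: Int_absorb2)
    finally show ?thesis by (simp add: mult.commute)
  qed
  then show ?thesis
    using fin by (auto intro!: continuous_map_sum continuous_map_real_mult cont)
qed

text \<open>
  Independent draws from the empirical measure are the data read off at independent uniform
  positions. For two samples the same positions can then be used.
\<close>

lemma bootstrap_approx_eq_distr:
  assumes "n \<ge> 1"
  shows "bootstrap_approx n z =
    distr (uniform_indices n n) (vec_space n) (\<lambda>J. \<lambda>i\<in>{1..n}. z (J i))"
proof -
  \<comment> \<open>\<open>borel\<close> is not a probability measure; \<open>return borel 0\<close> has the same \<open>\<sigma>\<close>-algebra and is one, as the
    theorem on images of product measures requires.\<close>
  have "bootstrap_approx n z =
      Pi\<^sub>M {1..n} (\<lambda>_. distr (uniform_count_measure {1..n}) (return borel (0::real)) z)"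
    unfolding bootstrap_approx_def empirical_eq_distr[OF assms]
    by (intro PiM_cong distr_cong) auto
  also have "\<dots> = distr (uniform_indices n n) (Pi\<^sub>M {1..n} (\<lambda>_. return borel 0)) (compose {1..n} z)"
    using assms by (intro distr_PiM_finite_prob_space'[symmetric])
      (auto intro!: prob_space_uniform_index measurable_from_uniform prob_space_return)
  also have "\<dots> = distr (uniform_indices n n) (vec_space n) (\<lambda>J. \<lambda>i\<in>{1..n}. z (J i))"
    by (intro distr_cong sets_PiM_cong) (auto simp: compose_def)
  finally show ?thesis .
qed

lemma mod_add_one_mem: "n \<noteq> 0 \<Longrightarrow> m mod n + 1 \<in> {1..n::nat}"
  using mod_less_divisor[of n m] by (simp add: Suc_le_eq One_nat_def)

text \<open>
  Injectivity suffices on a finite set; two points with the same image differ by a multiple of \<open>n\<close>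
  smaller than \<open>n\<close>.
\<close>

lemma bij_betw_cyclic_shift:
  "bij_betw (\<lambda>i. (i + c - 1) mod n + 1) {1..n} {1..n::nat}"
proof (cases "n = 0")
  case False
  define s where "s i = (i + c - 1) mod n + 1" for i
  have s: "s ` {1..n} \<subseteq> {1..n}"
    using False mod_add_one_mem[of n] unfolding s_def by blast
  have le: "i' = i" if "i \<in> {1..n}" "i' \<in> {1..n}" "s i = s i'" "i \<le> i'" for i i'
  proof -
    have "n dvd (i' + c - 1) - (i + c - 1)"
      using that by (subst mod_eq_dvd_iff_nat[symmetric]) (auto simp: s_def)
    moreover have "(i' + c - 1) - (i + c - 1) = i' - i" using that by auto
    ultimately have "n dvd i' - i" by simp
    moreover have "i' - i < n" using that by auto
    ultimately have "i' - i = 0" by (metis nat_dvd_not_less gr0I)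
    then show ?thesis using that by simp
  qed
  have "inj_on s {1..n}"
  proof (rule inj_onI)
    fix i i' assume "i \<in> {1..n}" "i' \<in> {1..n}" "s i = s i'"
    then show "i = i'" using le[of i i'] le[of i' i] by (metis nat_le_linear)
  qed
  then have "bij_betw s {1..n} {1..n}"
    using s by (simp add: bij_betw_def endo_inj_surj)
  moreover have "s = (\<lambda>i. (i + c - 1) mod n + 1)" by (rule ext) (rule s_def)
  ultimately show ?thesis by (simp only:)
qed (simp add: bij_betw_def)

lemma nth_concat_equal_length:
  assumes "\<And>x. x \<in> set xs \<Longrightarrow> length (f x) = b" "j < length xs * b"
  shows "concat (map f xs) ! j = f (xs ! (j div b)) ! (j mod b)"
  using assms
proof (induction xs arbitrary: j)
  case (Cons x xs)
  have len: "length (f x) = b" using Cons.prems by simp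
  have b: "b > 0" using Cons.prems by (cases b) auto
  show ?case
  proof (cases "j < b")
    case True
    then show ?thesis using len by (simp add: nth_append)
  next
    case False
    have "concat (map f xs) ! (j - b) = f (xs ! ((j - b) div b)) ! ((j - b) mod b)"
      using Cons.prems False by (intro Cons.IH) auto
    then show ?thesis
      using False len b by (simp add: nth_append le_div_geq le_mod_geq)
  qed
qed simp

section \<open>Moving block bootstrap as uniform resampling\<close>

text \<open>
  The position in the original sample of the \<open>j\<close>-th entry of the bootstrap sample: block number
  \<open>(j - 1) div b + 1\<close>, offset \<open>(j - 1) mod b\<close> within the block, wrapped around cyclically.
\<close>

definition block_index :: "nat \<Rightarrow> nat \<Rightarrow> (nat \<Rightarrow> nat) \<Rightarrow> nat \<Rightarrow> nat" where
  "block_index n b I j = (I ((j - 1) div b + 1) + (j - 1) mod b - 1) mod n + 1"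

lemma block_index_mem: "n \<ge> 1 \<Longrightarrow> block_index n b I j \<in> {1..n}"
  unfolding block_index_def by (intro mod_add_one_mem) auto

lemma bootstrap_sample_eq:
  assumes "b \<ge> 1" "n \<le> l * b"
  shows "bootstrap_sample n b l z I = (\<lambda>j\<in>{1..n}. z (block_index n b I j))"
proof -
  have "take n (concat (map (\<lambda>k. block n b z (I k)) [1..<l + 1])) ! (j - 1) = z (block_index n b I j)"
    if j: "j \<in> {1..n}" for j
  proof -
    have lt: "(j - 1) div b < l"
      using assms j by (subst div_less_iff_less_mult) auto
    have "take n (concat (map (\<lambda>k. block n b z (I k)) [1..<l + 1])) ! (j - 1)
        = concat (map (\<lambda>k. block n b z (I k)) [1..<l + 1]) ! (j - 1)"
      using j by (intro nth_take) auto
    also have "\<dots> = block n b z (I ([1..<l + 1] ! ((j - 1) div b))) ! ((j - 1) mod b)"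
      using assms j by (intro nth_concat_equal_length) (auto simp: block_def)
    also have "[1..<l + 1] ! ((j - 1) div b) = (j - 1) div b + 1"
      using lt by (subst nth_upt) auto
    also have "block n b z (I ((j - 1) div b + 1)) ! ((j - 1) mod b) = z (block_index n b I j)"
      using assms by (simp add: block_def circular_def block_index_def)
    finally show ?thesis .
  qed
  then show ?thesis
    unfolding bootstrap_sample_def Let_def by (intro restrict_ext)
qed

text \<open>
  Each resampled position is a fixed permutation of a uniform index, hence uniform itself. So each
  coordinate of the resampled pair contributes the average over the original coordinates; the joint
  distribution of the positions is irrelevant, because only an expected sum is computed.
\<close>

lemma integral_mean_dist_resampled:
  assumes n: "n \<ge> 1"
    and k: "\<And>i. i \<in> {1..n} \<Longrightarrow> k i \<in> {1..m}"
    and bij: "\<And>i. i \<in> {1..n} \<Longrightarrow> bij_betw (\<sigma> i) {1..n} {1..n}"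
  shows "(\<integral>I. mean_dist n (\<lambda>i\<in>{1..n}. z (\<sigma> i (I (k i)))) (\<lambda>i\<in>{1..n}. z' (\<sigma> i (I (k i))))
      \<partial>uniform_indices m n) = mean_dist n z z'"
proof -
  let ?g = "\<lambda>j. min 2 (dist (z j) (z' j))"
  have "(\<integral>I. mean_dist n (\<lambda>i\<in>{1..n}. z (\<sigma> i (I (k i)))) (\<lambda>i\<in>{1..n}. z' (\<sigma> i (I (k i))))
      \<partial>uniform_indices m n) = (\<integral>I. (\<Sum>i=1..n. ?g (\<sigma> i (I (k i)))) / real n \<partial>uniform_indices m n)"
    by (simp add: mean_dist_def)
  also have "\<dots> = (\<Sum>i=1..n. (\<integral>I. ?g (\<sigma> i (I (k i))) \<partial>uniform_indices m n)) / real n"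
    using n by (simp add: Bochner_Integration.integral_sum)
  also have "(\<Sum>i=1..n. (\<integral>I. ?g (\<sigma> i (I (k i))) \<partial>uniform_indices m n))
      = (\<Sum>i=1..n. mean_dist n z z')"
  proof (rule sum.cong)
    fix i assume i: "i \<in> {1..n}"
    have "(\<integral>I. ?g (\<sigma> i (I (k i))) \<partial>uniform_indices m n) = (\<Sum>j=1..n. ?g (\<sigma> i j)) / real n"
      using integral_uniform_indices_component[OF n k[OF i], of "\<lambda>j. ?g (\<sigma> i j)"] by simp
    also have "(\<Sum>j=1..n. ?g (\<sigma> i j)) = (\<Sum>j=1..n. ?g j)"
      by (rule sum.reindex_bij_betw[OF bij[OF i]])
    finally show "(\<integral>I. ?g (\<sigma> i (I (k i))) \<partial>uniform_indices m n) = mean_dist n z z'"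
      by (simp add: mean_dist_def)
  qed simp
  also have "(\<Sum>i=1..n. mean_dist n z z') / real n = mean_dist n z z'"
    using n by simp
  finally show ?thesis .
qed

text \<open>
  Thanks to the circular extension of the data, a block start shifted by a fixed offset is still
  uniform, and cutting the last block does not change this for the entries that are kept.
\<close>

lemma integral_mean_dist_bootstrap_sample:
  assumes "n \<ge> 1" "b \<ge> 1" "n \<le> l * b"
  shows "(\<integral>I. mean_dist n (bootstrap_sample n b l z I) (bootstrap_sample n b l z' I)
      \<partial>uniform_indices l n) = mean_dist n z z'"
proof -
  have k: "(j - 1) div b + 1 \<in> {1..l}" if "j \<in> {1..n}" for j
  proof -
    have "(j - 1) div b < l"
      using assms that by (subst div_less_iff_less_mult) auto
    then show ?thesis unfolding atLeastAtMost_iff by linarith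
  qed
  have bij: "bij_betw (\<lambda>i. (i + (j - 1) mod b - 1) mod n + 1) {1..n} {1..n}" for j
    by (rule bij_betw_cyclic_shift)
  show ?thesis
    unfolding bootstrap_sample_eq[OF assms(2,3)] block_index_def
    by (rule integral_mean_dist_resampled[where z = z and z' = z' and k = "\<lambda>j. (j - 1) div b + 1"
      and \<sigma> = "\<lambda>j i. (i + (j - 1) mod b - 1) mod n + 1", OF assms(1) k bij])
qed

section \<open>Measurability of the random law of the estimator\<close>

lemma borel_of_euclidean: "borel_of euclidean = borel"
  by (simp add: borel_of_def borel_def)

lemma sets_borel_of: "sets (borel_of T) = sigma_sets (topspace T) {U. openin T U}"
  unfolding borel_of_def by (rule sets_measure_of) (auto dest: openin_subset)

text \<open>
  A point of the product over \<open>J\<close> is an extensional function and hence itself a total function, and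
  restriction to \<open>J\<close> is continuous on the space of all total functions. There the product and the Borel
  \<open>\<sigma>\<close>-algebra coincide, because the index type is countable and the factors are second countable.
\<close>

lemma measurable_PiM_continuous_map:
  fixes f :: "('i::countable \<Rightarrow> 'b::second_countable_topology) \<Rightarrow> 'c"
  assumes f: "continuous_map (product_topology (\<lambda>_. euclidean) J) T f"
  shows "f \<in> Pi\<^sub>M J (\<lambda>_. borel) \<rightarrow>\<^sub>M borel_of T"
proof (rule measurable_sigma_sets[OF sets_borel_of])
  show "f \<in> space (Pi\<^sub>M J (\<lambda>_. borel)) \<rightarrow> topspace T"
    using continuous_map_image_subset_topspace[OF f] by (auto simp: space_PiM)
  fix U assume "U \<in> {U. openin T U}"
  then have A: "openin (product_topology (\<lambda>_. euclidean) J) {x \<in> PiE J (\<lambda>_. UNIV). f x \<in> U}"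
    using openin_continuous_map_preimage[OF f, of U] by simp
  have r: "continuous_map euclidean (product_topology (\<lambda>_. euclidean) J)
      (\<lambda>x::'i \<Rightarrow> 'b. restrict x J)"
    by (auto simp: continuous_map_componentwise restrict_def extensional_def
        euclidean_product_topology[symmetric] intro!: continuous_map_product_projection)
  have "openin euclidean {x \<in> topspace (euclidean :: ('i \<Rightarrow> 'b) topology).
      restrict x J \<in> {x \<in> PiE J (\<lambda>_. UNIV). f x \<in> U}}"
    by (rule openin_continuous_map_preimage[OF r A])
  then have "{x :: 'i \<Rightarrow> 'b. f (restrict x J) \<in> U} \<in> sets (Pi\<^sub>M UNIV (\<lambda>_. borel))"
    by (subst sets_PiM_equal_borel) (auto simp: open_openin[symmetric])
  moreover have "(\<lambda>x. x) \<in> Pi\<^sub>M J (\<lambda>_. borel :: 'b measure) \<rightarrow>\<^sub>M Pi\<^sub>M UNIV (\<lambda>_. borel)"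
  proof (rule measurable_PiM_single')
    fix i :: 'i
    show "(\<lambda>x. x i) \<in> Pi\<^sub>M J (\<lambda>_. borel :: 'b measure) \<rightarrow>\<^sub>M borel"
    proof (cases "i \<in> J")
      case False
      then have "(\<lambda>x. x i) \<in> Pi\<^sub>M J (\<lambda>_. borel :: 'b measure) \<rightarrow>\<^sub>M borel \<longleftrightarrow>
          (\<lambda>x. undefined) \<in> Pi\<^sub>M J (\<lambda>_. borel :: 'b measure) \<rightarrow>\<^sub>M (borel :: 'b measure)"
        by (intro measurable_cong) (auto simp: space_PiM PiE_def extensional_def)
      then show ?thesis by simp
    qed simp
  qed auto
  ultimately have "(\<lambda>x. x) -` {x. f (restrict x J) \<in> U} \<inter> space (Pi\<^sub>M J (\<lambda>_. borel))
      \<in> sets (Pi\<^sub>M J (\<lambda>_. borel))"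
    by (rule measurable_sets[rotated])
  also have "(\<lambda>x. x) -` {x. f (restrict x J) \<in> U} \<inter> space (Pi\<^sub>M J (\<lambda>_. borel))
      = f -` U \<inter> space (Pi\<^sub>M J (\<lambda>_. borel))"
    by (auto simp: space_PiM PiE_restrict)
  finally show "f -` U \<inter> space (Pi\<^sub>M J (\<lambda>_. borel)) \<in> sets (Pi\<^sub>M J (\<lambda>_. borel))" .
qed (auto dest: openin_subset)

lemma topspace_weak_topology:
  "topspace (weak_topology :: 'a::topological_space measure topology) = space (prob_algebra borel)"
proof -
  have "space (prob_algebra borel) \<in>
     {{\<mu> \<in> space (prob_algebra borel). (\<integral>x. f x \<partial>\<mu>) \<in> U} | (f :: 'a \<Rightarrow> real) U.
        continuous_on UNIV f \<and> bounded (range f) \<and> open U}"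
    by (intro CollectI exI[of _ "\<lambda>_. 0"] exI[of _ UNIV]) auto
  then show ?thesis
    unfolding weak_topology_def topology_generated_by_topspace by blast
qed

lemma continuous_map_weak_topologyI:
  fixes L :: "'x \<Rightarrow> 'a::topological_space measure"
  assumes prob: "\<And>x. x \<in> topspace X \<Longrightarrow> L x \<in> space (prob_algebra borel)"
    and cont: "\<And>f :: 'a \<Rightarrow> real. continuous_on UNIV f \<Longrightarrow> bounded (range f) \<Longrightarrow>
        continuous_map X euclideanreal (\<lambda>x. \<integral>y. f y \<partial>L x)"
  shows "continuous_map X weak_topology L"
  unfolding weak_topology_def
proof (rule continuous_on_generated_topo)
  fix W assume "W \<in> {{\<mu> \<in> space (prob_algebra borel). (\<integral>x. f x \<partial>\<mu>) \<in> U} | (f :: 'a \<Rightarrow> real) U.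
        continuous_on UNIV f \<and> bounded (range f) \<and> open U}"
  then obtain f :: "'a \<Rightarrow> real" and U where
    W: "W = {\<mu> \<in> space (prob_algebra borel). (\<integral>x. f x \<partial>\<mu>) \<in> U}"
    and f: "continuous_on UNIV f" "bounded (range f)" and U: "open U" by blast
  have "openin X {x \<in> topspace X. (\<integral>y. f y \<partial>L x) \<in> U}"
    using openin_continuous_map_preimage[OF cont[OF f], of U] U by (simp add: open_openin[symmetric])
  also have "{x \<in> topspace X. (\<integral>y. f y \<partial>L x) \<in> U} = L -` W \<inter> topspace X"
    using prob by (auto simp: W)
  finally show "openin X (L -` W \<inter> topspace X)" .
next
  show "L ` topspace X \<subseteq> \<Union> {{\<mu> \<in> space (prob_algebra borel). (\<integral>x. f x \<partial>\<mu>) \<in> U} | (f :: 'a \<Rightarrow> real) U.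
        continuous_on UNIV f \<and> bounded (range f) \<and> open U}"
    using prob topspace_weak_topology
    unfolding weak_topology_def topology_generated_by_topspace by blast
qed

lemma continuous_map_select:
  assumes "\<And>i. i \<in> I \<Longrightarrow> q i \<in> J"
  shows "continuous_map (product_topology (\<lambda>_. X) J) (product_topology (\<lambda>_. X) I)
    (\<lambda>z. \<lambda>i\<in>I. z (q i))"
  using assms
  by (auto simp: continuous_map_componentwise intro: continuous_map_product_projection)

lemma estimator_law_eq_distr:
  assumes n: "n \<ge> 1" and T: "T \<in> vec_space n \<rightarrow>\<^sub>M borel"
  shows "distr (bootstrap_approx n z) borel T =
    distr (uniform_indices n n) borel (\<lambda>J. T (\<lambda>i\<in>{1..n}. z (J i)))"
proof -
  have "(\<lambda>J. \<lambda>i\<in>{1..n}. z (J i)) \<in> uniform_indices n n \<rightarrow>\<^sub>M vec_space n"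
    by (simp add: measurable_cong_sets[OF sets_uniform_indices refl] space_PiM Pi_iff)
  then show ?thesis
    using T by (simp add: bootstrap_approx_eq_distr[OF n] distr_distr comp_def)
qed

lemma estimator_law_in_prob_algebra:
  assumes "n \<ge> 1" "T \<in> vec_space n \<rightarrow>\<^sub>M borel"
  shows "distr (bootstrap_approx n z) borel T \<in> space (prob_algebra borel)"
  using assms by (auto simp: estimator_law_eq_distr space_prob_algebra
      intro!: prob_space.prob_space_distr prob_space_uniform_indices measurable_uniform_indices)

text \<open>
  For a fixed choice of the blocks the integral of a continuous bounded \<open>f\<close> with respect to the law
  of the estimator is an average, over the finitely many index vectors \<open>J\<close>, of \<open>f\<close> applied to a
  continuous function of the data.
\<close>

lemma continuous_map_estimator_law:
  fixes T :: "(nat \<Rightarrow> real) \<Rightarrow> 'h::topological_space"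
  assumes n: "n \<ge> 1" and b: "b \<ge> 1" "n \<le> l * b"
    and T: "continuous_map (product_topology (\<lambda>_. euclidean) {1..n}) euclidean T"
  shows "continuous_map (product_topology (\<lambda>_. euclidean) {1..n}) weak_topology
    (\<lambda>z. distr (bootstrap_approx n (bootstrap_sample n b l z I)) borel T)"
proof (rule continuous_map_weak_topologyI)
  have [measurable]: "T \<in> vec_space n \<rightarrow>\<^sub>M borel"
    using measurable_PiM_continuous_map[OF T] by (simp add: borel_of_euclidean)
  show "distr (bootstrap_approx n (bootstrap_sample n b l z I)) borel T \<in> space (prob_algebra borel)" for z
    using n by (intro estimator_law_in_prob_algebra) auto
  fix f :: "'h \<Rightarrow> real" assume f: "continuous_on UNIV f"
  have [measurable]: "f \<in> borel_measurable borel" by (rule borel_measurable_continuous_onI[OF f])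
  have "(\<integral>y. f y \<partial>distr (bootstrap_approx n (bootstrap_sample n b l z I)) borel T) =
      (\<integral>J. f (T (\<lambda>i\<in>{1..n}. z (block_index n b I (J i)))) \<partial>uniform_indices n n)" for z
  proof -
    have "(\<integral>y. f y \<partial>distr (bootstrap_approx n (bootstrap_sample n b l z I)) borel T) =
        (\<integral>J. f (T (\<lambda>i\<in>{1..n}. bootstrap_sample n b l z I (J i))) \<partial>uniform_indices n n)"
      using n by (subst estimator_law_eq_distr) (auto intro!: integral_distr measurable_uniform_indices)
    also have "\<dots> = (\<integral>J. f (T (\<lambda>i\<in>{1..n}. z (block_index n b I (J i)))) \<partial>uniform_indices n n)"
    proof (intro Bochner_Integration.integral_cong refl arg_cong[of _ _ f] arg_cong[of _ _ T] restrict_ext)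
      fix J i assume "J \<in> space (uniform_indices n n)" "i \<in> {1..n}"
      then have "J i \<in> {1..n}" unfolding space_uniform_indices by (rule PiE_mem)
      then show "bootstrap_sample n b l z I (J i) = z (block_index n b I (J i))"
        by (simp add: bootstrap_sample_eq[OF b])
    qed
    finally show ?thesis .
  qed
  moreover have "continuous_map (product_topology (\<lambda>_. euclidean) {1..n}) euclideanreal
      (\<lambda>z. \<integral>J. f (T (\<lambda>i\<in>{1..n}. z (block_index n b I (J i)))) \<partial>uniform_indices n n)"
  proof (rule continuous_map_integral_uniform_indices[OF n])
    fix J
    have "continuous_map (product_topology (\<lambda>_. euclidean) {1..n}) (product_topology (\<lambda>_. euclidean) {1..n})
        (\<lambda>z::nat \<Rightarrow> real. \<lambda>i\<in>{1..n}. z (block_index n b I (J i)))"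
      by (intro continuous_map_select block_index_mem n)
    from continuous_map_compose[OF continuous_map_compose[OF this T], of euclideanreal f]
    show "continuous_map (product_topology (\<lambda>_. euclidean) {1..n}) euclideanreal
        (\<lambda>z. f (T (\<lambda>i\<in>{1..n}. z (block_index n b I (J i)))))"
      using f by (simp add: comp_def)
  qed
  ultimately show "continuous_map (product_topology (\<lambda>_. euclidean) {1..n}) euclideanreal
     (\<lambda>z. \<integral>y. f y \<partial>distr (bootstrap_approx n (bootstrap_sample n b l z I)) borel T)"
    by simp
qed

text \<open>
  There are only finitely many choices of blocks, and for each of them the map is continuous in the
  data.
\<close>

lemma measurable_estimator_law:
  fixes T :: "(nat \<Rightarrow> real) \<Rightarrow> 'h::topological_space"
  assumes n: "n \<ge> 1" and b: "b \<ge> 1" "n \<le> l * b"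
    and T: "continuous_map (product_topology (\<lambda>_. euclidean) {1..n}) euclidean T"
    and M: "sets M = sets (vec_space n)"
  shows "(\<lambda>(z, I). distr (bootstrap_approx n (bootstrap_sample n b l z I)) borel T)
    \<in> M \<Otimes>\<^sub>M uniform_indices l n \<rightarrow>\<^sub>M borel_of weak_topology"
proof -
  have "(\<lambda>(I, z). distr (bootstrap_approx n (bootstrap_sample n b l z I)) borel T)
      \<in> count_space (PiE {1..l} (\<lambda>_. {1..n})) \<Otimes>\<^sub>M vec_space n \<rightarrow>\<^sub>M borel_of weak_topology"
  proof (rule measurable_pair_measure_countable1)
    show "countable (PiE {1..l} (\<lambda>_. {1..n}))"
      by (intro countable_finite finite_PiE) auto
    show "(\<lambda>y. case (I, y) of (I, z) \<Rightarrow> distr (bootstrap_approx n (bootstrap_sample n b l z I)) borel T)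
        \<in> vec_space n \<rightarrow>\<^sub>M borel_of weak_topology" for I
      using measurable_PiM_continuous_map[OF continuous_map_estimator_law[OF n b T, of I]] by simp
  qed
  from measurable_pair_swap[OF this] show ?thesis
    by (simp add: measurable_cong_sets[OF sets_pair_measure_cong[OF M sets_uniform_indices] refl])
qed

section \<open>Robustness\<close>

text \<open>
  The infimal convolution \<open>g x = inf\<^sub>y (f y + K * D x y)\<close> is the largest \<open>K\<close>-Lipschitz function
  below \<open>f\<close>. The assumed modulus of \<open>f\<close> is exactly the statement that it loses at most \<open>\<epsilon>\<close>.
\<close>

lemma lipschitz_lower_approximation:
  fixes f :: "'x \<Rightarrow> real" and D :: "'x \<Rightarrow> 'x \<Rightarrow> real"
  assumes D: "\<And>x y. 0 \<le> D x y" "\<And>x. D x x = 0" "\<And>x y. D x y = D y x"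
      "\<And>x y z. D x z \<le> D x y + D y z"
    and f: "\<And>x. x \<in> X \<Longrightarrow> \<bar>f x\<bar> \<le> 1"
    and mod: "\<And>x y. x \<in> X \<Longrightarrow> y \<in> X \<Longrightarrow> \<bar>f x - f y\<bar> \<le> \<epsilon> + K * D x y"
    and K: "0 \<le> K"
  obtains g where "\<And>x. x \<in> X \<Longrightarrow> \<bar>g x\<bar> \<le> 1" "\<And>x. x \<in> X \<Longrightarrow> \<bar>f x - g x\<bar> \<le> \<epsilon>"
    "\<And>x y. x \<in> X \<Longrightarrow> y \<in> X \<Longrightarrow> \<bar>g x - g y\<bar> \<le> K * D x y"
proof
  define g where "g x = (INF y\<in>X. f y + K * D x y)" for x
  have bdd: "bdd_below ((\<lambda>y. f y + K * D x y) ` X)" for x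
  proof (rule bdd_belowI2)
    fix y assume "y \<in> X"
    then show "-1 \<le> f y + K * D x y"
      using f[of y] mult_nonneg_nonneg[OF K D(1)[of x y]] by linarith
  qed
  have le: "g x \<le> f y + K * D x y" if "y \<in> X" for x y
    unfolding g_def by (rule cINF_lower[OF bdd that])
  have ge: "c \<le> g x" if "x \<in> X" "\<And>y. y \<in> X \<Longrightarrow> c \<le> f y + K * D x y" for c x
    unfolding g_def using that by (intro cINF_greatest) auto
  have g_le_f: "g x \<le> f x" if "x \<in> X" for x
    using le[OF that, of x] by (simp add: D)
  show "\<bar>g x\<bar> \<le> 1" if x: "x \<in> X" for x
  proof -
    have "-1 \<le> g x"
    proof (rule ge[OF x])
      fix y assume "y \<in> X"
      then show "-1 \<le> f y + K * D x y"
        using f[of y] mult_nonneg_nonneg[OF K D(1)[of x y]] by linarith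
    qed
    then show ?thesis using g_le_f[OF x] f[OF x] by linarith
  qed
  show "\<bar>f x - g x\<bar> \<le> \<epsilon>" if x: "x \<in> X" for x
  proof -
    have "f x - \<epsilon> \<le> g x"
    proof (rule ge[OF x])
      fix y assume "y \<in> X"
      then show "f x - \<epsilon> \<le> f y + K * D x y" using mod[OF x, of y] by linarith
    qed
    then show ?thesis using g_le_f[OF x] by linarith
  qed
  have half: "g x \<le> g y + K * D x y" if "y \<in> X" for x y
  proof -
    have "g x - K * D x y \<le> g y"
    proof (rule ge[OF that])
      fix w assume w: "w \<in> X"
      have "K * D x w \<le> K * D x y + K * D y w"
        using mult_left_mono[OF D(4)[of x w y] K] by (simp add: distrib_left)
      then show "g x - K * D x y \<le> f w + K * D y w" using le[OF w, of x] by linarith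
    qed
    then show ?thesis by linarith
  qed
  show "\<bar>g x - g y\<bar> \<le> K * D x y" if "x \<in> X" "y \<in> X" for x y
    using half[of y x] half[of x y] that D(3)[of x y] by auto
qed

lemma measurable_mean_dist_lipschitz:
  assumes g: "\<And>x y. x \<in> space (vec_space n) \<Longrightarrow> y \<in> space (vec_space n) \<Longrightarrow>
      \<bar>g x - g y\<bar> \<le> K * mean_dist n x y"
  shows "g \<in> borel_measurable (vec_space n)"
proof -
  let ?X = "product_topology (\<lambda>_. euclideanreal) {1..n}"
  have sp: "topspace ?X = space (vec_space n)" by (simp add: space_PiM)
  have "continuous_map ?X euclideanreal g"
    unfolding continuous_map_atin
  proof
    fix x assume x: "x \<in> topspace ?X"
    have "continuous_map ?X euclideanreal (\<lambda>y. K * mean_dist n y x)"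
      unfolding mean_dist_def dist_real_def divide_inverse
      by (intro continuous_map_real_mult continuous_map_sum continuous_map_real_min
          continuous_map_real_abs continuous_map_diff continuous_map_product_projection) auto
    then have "((\<lambda>y. K * mean_dist n y x) \<longlongrightarrow> 0) (atin ?X x)"
      using x by (force simp: continuous_map_atin)
    moreover have "\<forall>\<^sub>F y in atin ?X x. norm (g y - g x) \<le> K * mean_dist n y x"
      unfolding eventually_atin using x g sp by (auto intro!: exI[of _ "topspace ?X"])
    ultimately have "((\<lambda>y. g y - g x) \<longlongrightarrow> 0) (atin ?X x)"
      by (rule Lim_null_comparison[rotated])
    then show "limitin euclideanreal g (g x) (atin ?X x)"
      by (simp add: LIM_zero_iff)
  qed
  from measurable_PiM_continuous_map[OF this] show ?thesis
    by (simp add: borel_of_euclidean)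
qed

text \<open>
  For measures closer than the \<open>\<delta>\<close> of uniform continuity the term \<open>\<epsilon>\<close> suffices; for all others
  \<open>K * d_BL UNIV dist \<mu> \<nu> \<ge> 2\<close> with \<open>K = 2 / \<delta>\<close>. An affine bound, in contrast to an
  \<open>\<epsilon>\<close>-\<open>\<delta>\<close> condition, can be integrated.
\<close>

lemma uniformly_continuous_affine_bound:
  fixes S :: "real measure \<Rightarrow> 'h::metric_space"
  assumes unif: "\<forall>\<epsilon>>0. \<exists>\<delta>>0. \<forall>\<mu>\<in>space (prob_algebra borel). \<forall>\<nu>\<in>space (prob_algebra borel).
           d_BL UNIV dist \<mu> \<nu> < \<delta> \<longrightarrow> dist (S \<mu>) (S \<nu>) < \<epsilon>"
    and "\<epsilon> > 0"
  obtains K where "K \<ge> 0"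
    "\<And>\<mu> \<nu>. \<mu> \<in> space (prob_algebra borel) \<Longrightarrow> \<nu> \<in> space (prob_algebra borel) \<Longrightarrow>
      min 2 (dist (S \<mu>) (S \<nu>)) \<le> \<epsilon> + K * d_BL UNIV dist \<mu> \<nu>"
proof -
  obtain \<delta> where \<delta>: "\<delta> > 0" "\<And>\<mu> \<nu>. \<mu> \<in> space (prob_algebra borel) \<Longrightarrow>
      \<nu> \<in> space (prob_algebra borel) \<Longrightarrow> d_BL UNIV dist \<mu> \<nu> < \<delta> \<Longrightarrow> dist (S \<mu>) (S \<nu>) < \<epsilon>"
    using unif \<open>\<epsilon> > 0\<close> by metis
  show thesis
  proof
    show "0 \<le> 2 / \<delta>" using \<delta> by simp
    fix \<mu> \<nu> :: "real measure"
    assume mem: "\<mu> \<in> space (prob_algebra borel)" "\<nu> \<in> space (prob_algebra borel)"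
    have d0: "0 \<le> d_BL UNIV dist \<mu> \<nu>"
      by (intro d_BL_nonneg) (auto simp: mem space_prob_algebra_borelD)
    show "min 2 (dist (S \<mu>) (S \<nu>)) \<le> \<epsilon> + 2 / \<delta> * d_BL UNIV dist \<mu> \<nu>"
    proof (cases "d_BL UNIV dist \<mu> \<nu> < \<delta>")
      case True
      have "0 \<le> 2 / \<delta> * d_BL UNIV dist \<mu> \<nu>" using \<delta>(1) d0 by simp
      then show ?thesis using \<delta>(2)[OF mem True] by linarith
    next
      case False
      then have "2 \<le> 2 / \<delta> * d_BL UNIV dist \<mu> \<nu>" using \<delta>(1) by (simp add: field_simps)
      then show ?thesis using \<open>\<epsilon> > 0\<close> by linarith
    qed
  qed
qed

text \<open>
  The inner resampling step: both laws are coupled by the same index vector, and the affine bound is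
  integrated over it.
\<close>

lemma d_BL_estimator_law_le:
  fixes S :: "real measure \<Rightarrow> 'h::{metric_space, second_countable_topology}"
  assumes n: "n \<ge> 1" and T: "T \<in> vec_space n \<rightarrow>\<^sub>M borel"
    and TS: "\<And>z. z \<in> space (vec_space n) \<Longrightarrow> T z = S (empirical n z)"
    and S: "\<And>\<mu> \<nu>. \<mu> \<in> space (prob_algebra borel) \<Longrightarrow> \<nu> \<in> space (prob_algebra borel) \<Longrightarrow>
      min 2 (dist (S \<mu>) (S \<nu>)) \<le> \<epsilon> + K * d_BL UNIV dist \<mu> \<nu>"
    and K: "K \<ge> 0"
  shows "d_BL UNIV dist (distr (bootstrap_approx n z) borel T) (distr (bootstrap_approx n z') borel T)
    \<le> \<epsilon> + K * mean_dist n z z'"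
proof -
  let ?U = "uniform_indices n n"
  let ?r = "\<lambda>z J. \<lambda>i\<in>{1..n}. z (J i)"
  interpret prob_space ?U by (rule prob_space_uniform_indices[OF n])
  have "d_BL UNIV dist (distr (bootstrap_approx n z) borel T) (distr (bootstrap_approx n z') borel T)
      \<le> (\<integral>J. min 2 (dist (T (?r z J)) (T (?r z' J))) \<partial>?U)"
    unfolding estimator_law_eq_distr[OF n T]
    by (intro d_BL_distr_le prob_space_axioms measurable_uniform_indices) auto
  also have "\<dots> \<le> (\<integral>J. \<epsilon> + K * mean_dist n (?r z J) (?r z' J) \<partial>?U)"
  proof (rule integral_mono)
    fix J
    have "min 2 (dist (T (?r z J)) (T (?r z' J)))
        \<le> \<epsilon> + K * d_BL UNIV dist (empirical n (?r z J)) (empirical n (?r z' J))"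
      using S[OF empirical_in_prob_algebra[OF n] empirical_in_prob_algebra[OF n], of "?r z J" "?r z' J"]
      by (simp add: TS space_PiM)
    also have "\<dots> \<le> \<epsilon> + K * mean_dist n (?r z J) (?r z' J)"
      using d_BL_empirical_le[OF n] K by (intro add_left_mono mult_left_mono)
    finally show "min 2 (dist (T (?r z J)) (T (?r z' J))) \<le> \<epsilon> + K * mean_dist n (?r z J) (?r z' J)" .
  qed (use n in auto)
  also have "\<dots> = \<epsilon> + K * (\<integral>J. mean_dist n (?r z J) (?r z' J) \<partial>?U)"
    using n by (simp add: prob_space)
  also have "(\<integral>J. mean_dist n (?r z J) (?r z' J) \<partial>?U) = mean_dist n z z'"
    by (rule integral_mean_dist_resampled[where k = "\<lambda>i. i" and \<sigma> = "\<lambda>_ j. j" and z = z and z' = z', OF n])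
      (auto simp: bij_betw_def)
  finally show ?thesis .
qed

text \<open>
  The constant arises from normalising \<open>g\<close>: its Lipschitz constant with respect to \<open>d_vec\<close> is at most
  \<open>3 * K\<close> and its supremum norm at most 1.
\<close>

lemma d_BL_vec_space_lipschitz:
  assumes n: "n \<ge> 1"
    and \<mu>: "prob_space \<mu>" "sets \<mu> = sets (vec_space n)"
    and \<nu>: "prob_space \<nu>" "sets \<nu> = sets (vec_space n)"
    and g: "\<And>z. z \<in> space (vec_space n) \<Longrightarrow> \<bar>g z\<bar> \<le> 1"
    and lip: "\<And>z z'. z \<in> space (vec_space n) \<Longrightarrow> z' \<in> space (vec_space n) \<Longrightarrow>
      \<bar>g z - g z'\<bar> \<le> K * mean_dist n z z'"
    and K: "K \<ge> 0"
  shows "\<bar>(\<integral>z. g z \<partial>\<mu>) - (\<integral>z. g z \<partial>\<nu>)\<bar> \<le> (3 * K + 1) * d_BL (space (vec_space n)) (d_vec n) \<mu> \<nu>"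
proof -
  let ?c = "3 * K + 1"
  have c: "?c > 0" using K by simp
  have "bl_norm (space (vec_space n)) (d_vec n) (\<lambda>z. g z / ?c) \<le> 1"
  proof (rule bl_norm_le_oneI[where L = "3 * K / ?c" and M = "1 / ?c"])
    fix z z' assume z: "z \<in> space (vec_space n)" "z' \<in> space (vec_space n)"
    show "0 \<le> d_vec n z z'"
      using mean_dist_le_d_vec[OF n, of z z'] mean_dist_nonneg[of n z z'] by linarith
    have "\<bar>g z - g z'\<bar> \<le> K * (3 * d_vec n z z')"
      using lip[OF z] mult_left_mono[OF mean_dist_le_d_vec[OF n, of z z'] K] by linarith
    then show "\<bar>g z / ?c - g z' / ?c\<bar> \<le> 3 * K / ?c * d_vec n z z'"
      using c by (simp add: diff_divide_distrib[symmetric] abs_div_pos[symmetric] divide_right_mono)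
  qed (use g c K in \<open>auto simp: divide_right_mono add_divide_distrib[symmetric]\<close>)
  then have "\<bar>(\<integral>z. g z / ?c \<partial>\<mu>) - (\<integral>z. g z / ?c \<partial>\<nu>)\<bar> \<le> d_BL (space (vec_space n)) (d_vec n) \<mu> \<nu>"
    using sets_eq_imp_space_eq[OF \<mu>(2)] sets_eq_imp_space_eq[OF \<nu>(2)]
    by (intro d_BL_upper \<mu> \<nu>) auto
  also have "(\<integral>z. g z / ?c \<partial>\<mu>) - (\<integral>z. g z / ?c \<partial>\<nu>) = ((\<integral>z. g z \<partial>\<mu>) - (\<integral>z. g z \<partial>\<nu>)) / ?c"
    by (simp add: diff_divide_distrib)
  finally show ?thesis using c by (simp add: abs_div_pos[symmetric] divide_le_eq mult.commute)
qed

text \<open>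
  The quantitative form of robustness; it holds for every sample size, with constants that depend
  neither on \<open>n\<close> nor on the two distributions. For a test function \<open>F\<close> on the space of laws,
  let \<open>f z\<close> be the conditional expectation of \<open>F\<close> given the data \<open>z\<close>. It satisfies the affine
  bound \<open>\<bar>f z - f z'\<bar> \<le> \<epsilon> + K * mean_dist n z z'\<close>, so a Lipschitz function \<open>g\<close>
  within \<open>\<epsilon>\<close> of it can be tested against the two data distributions.
\<close>

lemma d_BL_bootstrap_law_le:
  fixes S :: "real measure \<Rightarrow> 'h::{metric_space, second_countable_topology}"
  assumes n: "n \<ge> 1" and b: "b \<ge> 1" "n \<le> l * b"
    and \<mu>: "prob_space \<mu>" "sets \<mu> = sets (vec_space n)"
    and \<nu>: "prob_space \<nu>" "sets \<nu> = sets (vec_space n)"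
    and T: "continuous_map (product_topology (\<lambda>_. euclidean) {1..n}) euclidean T"
    and TS: "\<And>z. z \<in> space (vec_space n) \<Longrightarrow> T z = S (empirical n z)"
    and S: "\<And>\<mu> \<nu>. \<mu> \<in> space (prob_algebra borel) \<Longrightarrow> \<nu> \<in> space (prob_algebra borel) \<Longrightarrow>
      min 2 (dist (S \<mu>) (S \<nu>)) \<le> \<epsilon> + K * d_BL UNIV dist \<mu> \<nu>"
    and K: "K \<ge> 0" and \<epsilon>: "\<epsilon> > 0"
  shows "d_BL (space (prob_algebra borel)) (d_BL UNIV dist) (bootstrap_law n b l \<mu> T) (bootstrap_law n b l \<nu> T)
    \<le> 2 * \<epsilon> + (3 * K + 1) * d_BL (space (vec_space n)) (d_vec n) \<mu> \<nu>"
proof (rule d_BL_least)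
  fix F :: "'h measure \<Rightarrow> real"
  assume F: "bl_norm (space (prob_algebra borel)) (d_BL UNIV dist) F \<le> 1"
  let ?X = "space (vec_space n)"
  let ?U = "uniform_indices l n"
  let ?d = "d_BL ?X (d_vec n) \<mu> \<nu>"
  define L where "L z I = distr (bootstrap_approx n (bootstrap_sample n b l z I)) borel T" for z I
  define f where "f z = (\<integral>I. F (L z I) \<partial>?U)" for z
  interpret U: prob_space ?U by (rule prob_space_uniform_indices[OF n])
  have T_meas: "T \<in> vec_space n \<rightarrow>\<^sub>M borel"
    using measurable_PiM_continuous_map[OF T] by (simp add: borel_of_euclidean)
  have L_prob: "L z I \<in> space (prob_algebra borel)" for z I
    unfolding L_def by (rule estimator_law_in_prob_algebra[OF n T_meas])
  have F1: "\<bar>F (L z I)\<bar> \<le> 1" for z I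
    by (rule bl_norm_le_one_bounded[OF F L_prob])
  have f1: "\<bar>f z\<bar> \<le> 1" for z
    unfolding f_def by (rule prob_integral_abs_le[OF U.prob_space_axioms]) (auto simp: F1)
  have F_lip: "\<bar>F \<kappa> - F \<kappa>'\<bar> \<le> d_BL UNIV dist \<kappa> \<kappa>'"
    if mem: "\<kappa> \<in> space (prob_algebra borel)" "\<kappa>' \<in> space (prob_algebra borel)" for \<kappa> \<kappa>'
  proof (rule bl_norm_le_one_lipschitz[OF F mem])
    show nn: "0 \<le> d_BL UNIV dist \<kappa> \<kappa>'"
      by (intro d_BL_nonneg) (auto simp: mem space_prob_algebra_borelD)
    show "0 < d_BL UNIV dist \<kappa> \<kappa>'" if "\<kappa> \<noteq> \<kappa>'"
      using nn d_BL_eq_0_imp_eq[OF mem] that by (auto simp: less_le)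
  qed
  have f_mod: "\<bar>f z - f z'\<bar> \<le> \<epsilon> + K * mean_dist n z z'" for z z'
  proof -
    have "\<bar>f z - f z'\<bar> = \<bar>\<integral>I. F (L z I) - F (L z' I) \<partial>?U\<bar>"
      unfolding f_def using n by simp
    also have "\<dots> \<le> (\<integral>I. \<bar>F (L z I) - F (L z' I)\<bar> \<partial>?U)" by (rule integral_abs_bound)
    also have "\<dots> \<le> (\<integral>I. \<epsilon> + K * mean_dist n (bootstrap_sample n b l z I) (bootstrap_sample n b l z' I) \<partial>?U)"
    proof (rule integral_mono)
      show "\<bar>F (L z I) - F (L z' I)\<bar>
          \<le> \<epsilon> + K * mean_dist n (bootstrap_sample n b l z I) (bootstrap_sample n b l z' I)" for I
        using F_lip[OF L_prob L_prob, of z I z' I]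
          d_BL_estimator_law_le[OF n T_meas TS S K, of "bootstrap_sample n b l z I" "bootstrap_sample n b l z' I"]
        by (simp add: L_def)
    qed (use n in auto)
    also have "\<dots> = \<epsilon> + K * (\<integral>I. mean_dist n (bootstrap_sample n b l z I) (bootstrap_sample n b l z' I) \<partial>?U)"
      using n by (simp add: U.prob_space)
    also have "\<dots> = \<epsilon> + K * mean_dist n z z'"
      by (simp only: integral_mean_dist_bootstrap_sample[OF n b])
    finally show ?thesis .
  qed
  obtain g where g: "\<And>x. x \<in> ?X \<Longrightarrow> \<bar>g x\<bar> \<le> 1" "\<And>x. x \<in> ?X \<Longrightarrow> \<bar>f x - g x\<bar> \<le> \<epsilon>"
    "\<And>x y. x \<in> ?X \<Longrightarrow> y \<in> ?X \<Longrightarrow> \<bar>g x - g y\<bar> \<le> K * mean_dist n x y"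
    using lipschitz_lower_approximation[where D = "mean_dist n" and f = f and X = ?X and \<epsilon> = \<epsilon> and K = K]
      mean_dist_nonneg mean_dist_self mean_dist_commute mean_dist_triangle f1 f_mod K by metis
  have law: "\<bar>(\<integral>\<kappa>. F \<kappa> \<partial>bootstrap_law n b l M T) - (\<integral>z. g z \<partial>M)\<bar> \<le> \<epsilon>"
    if F_meas: "F \<in> borel_measurable (borel_of weak_topology)"
      and M: "prob_space M" "sets M = sets (vec_space n)" for M
  proof -
    interpret M: prob_space M by fact
    interpret MU: pair_prob_space M ?U ..
    have L_meas: "(\<lambda>(z, I). L z I) \<in> M \<Otimes>\<^sub>M ?U \<rightarrow>\<^sub>M borel_of weak_topology"
      unfolding L_def by (rule measurable_estimator_law[OF n b T M(2)])
    have FL_meas: "(\<lambda>(z, I). F (L z I)) \<in> borel_measurable (M \<Otimes>\<^sub>M ?U)"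
      using measurable_compose[OF L_meas F_meas] by (simp add: case_prod_unfold)
    have FL_int: "integrable (M \<Otimes>\<^sub>M ?U) (\<lambda>(z, I). F (L z I))"
      using FL_meas F1 by (intro MU.P.integrable_const_bound[where B = 1]) auto
    have "(\<integral>\<kappa>. F \<kappa> \<partial>bootstrap_law n b l M T) = (\<integral>(z, I). F (L z I) \<partial>(M \<Otimes>\<^sub>M ?U))"
      using integral_distr[OF L_meas F_meas]
      by (simp add: bootstrap_law_def L_def case_prod_unfold)
    also have "\<dots> = (\<integral>z. f z \<partial>M)"
      using MU.integral_fst'[OF FL_int] by (simp add: f_def)
    finally have eq: "(\<integral>\<kappa>. F \<kappa> \<partial>bootstrap_law n b l M T) = (\<integral>z. f z \<partial>M)" .
    have spM: "space M = ?X" by (rule sets_eq_imp_space_eq[OF M(2)])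
    have f_int: "integrable M f"
      using MU.integrable_fst'[OF FL_int] by (simp add: f_def[abs_def])
    have "g \<in> borel_measurable M"
      using measurable_mean_dist_lipschitz[OF g(3)] by (simp add: measurable_cong_sets[OF M(2) refl])
    then have g_int: "integrable M g"
      using g(1) spM by (intro M.integrable_const_bound[where B = 1]) auto
    have "(\<integral>z. f z \<partial>M) - (\<integral>z. g z \<partial>M) = (\<integral>z. f z - g z \<partial>M)"
      using f_int g_int by simp
    then show ?thesis
      unfolding eq using prob_integral_abs_le[OF M(1), of "\<lambda>z. f z - g z" \<epsilon>] g(2) spM \<epsilon> by simp
  qed
  show "\<bar>(\<integral>\<kappa>. F \<kappa> \<partial>bootstrap_law n b l \<mu> T) - (\<integral>\<kappa>. F \<kappa> \<partial>bootstrap_law n b l \<nu> T)\<bar>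
      \<le> 2 * \<epsilon> + (3 * K + 1) * ?d"
  proof (cases "F \<in> borel_measurable (borel_of weak_topology)")
    case True
    show ?thesis
      using law[OF True \<mu>] law[OF True \<nu>] d_BL_vec_space_lipschitz[OF n \<mu> \<nu> g(1) g(3) K] by linarith
  next
    \<comment> \<open>Both bootstrap laws live on the same \<open>\<sigma>\<close>-algebra, so a non-measurable \<open>F\<close> has integral 0 under both.\<close>
    case False
    have "(\<integral>\<kappa>. F \<kappa> \<partial>bootstrap_law n b l M T) = 0" for M
    proof (rule not_integrable_integral_eq)
      show "\<not> integrable (bootstrap_law n b l M T) F"
        using False borel_measurable_integrable[of "bootstrap_law n b l M T" F]
        by (auto simp: bootstrap_law_def)
    qed
    moreover have "0 \<le> ?d"
      using sets_eq_imp_space_eq[OF \<mu>(2)] sets_eq_imp_space_eq[OF \<nu>(2)]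
      by (intro d_BL_nonneg \<mu> \<nu>) auto
    ultimately show ?thesis using K \<epsilon> by simp
  qed
qed

lemma marginal_prob_space:
  assumes "P \<in> space (prob_algebra seq_space)"
  shows "prob_space (marginal n P)" "sets (marginal n P) = sets (vec_space n)"
proof -
  have P: "sets P = sets seq_space" "prob_space P" using assms by (auto simp: space_prob_algebra)
  have "(\<lambda>\<omega>. restrict \<omega> {1..n}) \<in> P \<rightarrow>\<^sub>M vec_space n"
    unfolding measurable_cong_sets[OF P(1) refl]
    by (intro measurable_restrict_subset) auto
  then show "prob_space (marginal n P)"
    unfolding marginal_def by (rule prob_space.prob_space_distr[OF P(2)])
qed (simp add: marginal_def)

theorem theorem2p6:
  fixes P :: "(nat \<Rightarrow> real) measure"
    and \<gamma> h a :: real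
    and S :: "real measure \<Rightarrow> 'h::{metric_space, second_countable_topology}"
    and Sn :: "nat \<Rightarrow> (nat \<Rightarrow> real) \<Rightarrow> 'h"
    and b l :: "nat \<Rightarrow> nat"
  assumes "\<gamma> > 0" and "P \<in> mixing_class \<gamma>"
    and "completely_metrizable_space (euclidean :: 'h topology)"
    and "\<And>n z. n \<ge> 1 \<Longrightarrow> z \<in> space (vec_space n) \<Longrightarrow> Sn n z = S (empirical n z)"
    and "\<And>n. n \<ge> 1 \<Longrightarrow>
           continuous_map (product_topology (\<lambda>_. euclidean) {1..n}) euclidean (Sn n)"
    and "\<forall>\<epsilon>>0. \<exists>\<delta>>0. \<forall>\<mu>\<in>space (prob_algebra borel). \<forall>\<nu>\<in>space (prob_algebra borel).
           d_BL UNIV dist \<mu> \<nu> < \<delta> \<longrightarrow> dist (S \<mu>) (S \<nu>) < \<epsilon>"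
    and "0 < a" and "a < 1/3" and "0 < h" and "h < 1/3 - a"
    and "(\<lambda>n. real n powr h) \<in> O(\<lambda>n. real (b n))"
    and "(\<lambda>n. real (b n)) \<in> O(\<lambda>n. real n powr (1/3 - a))"
    and "\<And>n q. 2 ^ q \<le> n \<Longrightarrow> n < 2 ^ (q + 1) \<Longrightarrow> b n = b (2 ^ q)"
    and "filterlim b at_top sequentially"
    and "\<And>n. n \<ge> 1 \<Longrightarrow> b n \<ge> 1" and "\<And>n. n \<ge> 2 \<Longrightarrow> b n < n"
    and "\<And>n. n \<ge> 1 \<Longrightarrow> l n = nat \<lceil>real n / real (b n)\<rceil>"
  shows "\<forall>\<epsilon>>0. \<exists>\<delta>>0. \<exists>n\<^sub>0\<ge>1. \<forall>n\<ge>n\<^sub>0. \<forall>Q\<in>mixing_class \<gamma>.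
           d_BL (space (vec_space n)) (d_vec n) (marginal n P) (marginal n Q) < \<delta> \<longrightarrow>
           d_BL (space (prob_algebra borel)) (d_BL UNIV dist)
             (bootstrap_law n (b n) (l n) (marginal n P) (Sn n))
             (bootstrap_law n (b n) (l n) (marginal n Q) (Sn n)) < \<epsilon>"
proof (intro allI impI)
  fix \<epsilon> :: real assume "\<epsilon> > 0"
  then obtain K where K: "K \<ge> 0"
    "\<And>\<mu> \<nu>. \<mu> \<in> space (prob_algebra borel) \<Longrightarrow> \<nu> \<in> space (prob_algebra borel) \<Longrightarrow>
      min 2 (dist (S \<mu>) (S \<nu>)) \<le> \<epsilon> / 4 + K * d_BL UNIV dist \<mu> \<nu>"
    using uniformly_continuous_affine_bound[OF assms(6), of "\<epsilon> / 4"] by auto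
  let ?c = "3 * K + 1"
  have c: "?c > 0" using K(1) by simp
  show "\<exists>\<delta>>0. \<exists>n\<^sub>0\<ge>1. \<forall>n\<ge>n\<^sub>0. \<forall>Q\<in>mixing_class \<gamma>.
           d_BL (space (vec_space n)) (d_vec n) (marginal n P) (marginal n Q) < \<delta> \<longrightarrow>
           d_BL (space (prob_algebra borel)) (d_BL UNIV dist)
             (bootstrap_law n (b n) (l n) (marginal n P) (Sn n))
             (bootstrap_law n (b n) (l n) (marginal n Q) (Sn n)) < \<epsilon>"
  \<comment> \<open>The affine bound with \<open>\<epsilon> / 4\<close> costs \<open>\<epsilon> / 2\<close> in total; this \<open>\<delta>\<close> spends the other half.\<close>
  proof (rule exI[of _ "\<epsilon> / (2 * ?c)"], intro conjI exI[of _ "1::nat"] allI ballI impI)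
    show "0 < \<epsilon> / (2 * ?c)" using c \<open>\<epsilon> > 0\<close> by simp
    fix n :: nat and Q
    assume n: "n \<ge> 1" and Q: "Q \<in> mixing_class \<gamma>"
      and close: "d_BL (space (vec_space n)) (d_vec n) (marginal n P) (marginal n Q) < \<epsilon> / (2 * ?c)"
    have PQ: "P \<in> space (prob_algebra seq_space)" "Q \<in> space (prob_algebra seq_space)"
      using assms(2) Q by (auto simp: mixing_class_def)
    have "real n / real (b n) \<le> real (l n)"
      unfolding assms(17)[OF n] by (simp add: of_nat_ceiling)
    then have len: "n \<le> l n * b n"
      using assms(15)[OF n] by (simp add: divide_le_eq flip: of_nat_mult)
    have "d_BL (space (prob_algebra borel)) (d_BL UNIV dist)
             (bootstrap_law n (b n) (l n) (marginal n P) (Sn n))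
             (bootstrap_law n (b n) (l n) (marginal n Q) (Sn n))
        \<le> 2 * (\<epsilon> / 4) + ?c * d_BL (space (vec_space n)) (d_vec n) (marginal n P) (marginal n Q)"
      using \<open>\<epsilon> > 0\<close>
      by (intro d_BL_bootstrap_law_le[where S = S] n assms(15)[OF n] len marginal_prob_space PQ
          assms(5)[OF n] assms(4)[OF n] K) auto
    also have "\<dots> < 2 * (\<epsilon> / 4) + ?c * (\<epsilon> / (2 * ?c))"
      using close c by (intro add_strict_left_mono mult_strict_left_mono)
    also have "\<dots> = \<epsilon>" using c by (simp add: field_simps)
    finally show "d_BL (space (prob_algebra borel)) (d_BL UNIV dist)
             (bootstrap_law n (b n) (l n) (marginal n P) (Sn n))
             (bootstrap_law n (b n) (l n) (marginal n Q) (Sn n)) < \<epsilon>" .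
  qed simp
qed

end
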